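(* Let $r_{\rm ss}(u):=\bar\tau_+u$ for $u\in[0,1]$. Then $$\sup_{u\in[1/n,1]}\big|\langle r_{[nu]}\rangle_{\rm ss}-r_{\rm ss}(u)\big|\xrightarrow[n\to\infty]{}0,$$ where $[\cdot]$ denotes the integer part. In particular, for any continuous function $G:[0,1]\to\mathbb R$, $$\frac1n\sum_{x=1}^nG\Big(\frac xn\Big)\langle r_x\rangle_{\rm ss}\xrightarrow[n\to\infty]{}\int_0^1G(u)\,r_{\rm ss}(u)\,\mathrm du .$$
   Context: Fix $\gamma>0$, $\tilde\gamma>0$, $T_->0$, $T_+>0$ and $\bar\tau_+\in\mathbb R$ (constant in time). For $n\ge1$ let $\Omega_n=\mathbb R^n\times\mathbb R^{n+1}$, with configurations $(\mathbf r,\mathbf p)=(r_1,\dots,r_n,p_0,\dots,p_n)$. Consider the diffusion on $\Omega_n$ with generator $L=n^2\big(A+\frac\gamma2S+\frac{\tilde\gamma}2\tilde S\big)$, where $$A=\sum_{x=1}^n(p_x-p_{x-1})\partial_{r_x}+\sum_{x=1}^{n-1}(r_{x+1}-r_x)\partial_{p_x}+r_1\partial_{p_0}+(\bar\tau_+-r_n)\partial_{p_n},$$ $$S=\sum_{x=0}^{n-1}\mathcal X_x\circ\mathcal X_x,\quad \mathcal X_x=p_{x+1}\partial_{p_x}-p_x\partial_{p_{x+1}},\qquad \tilde S=T_-\partial_{p_0}^2-p_0\partial_{p_0}+T_+\partial_{p_n}^2-p_n\partial_{p_n}.$$ It is known that for each $n$ this dynamics has a unique stationary probability measure $\mu_{\rm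 ss}$ on $\Omega_n$, and that it has finite second moments. Write $\langle F\rangle_{\rm ss}=\int_{\Omega_n}F\,\mathrm d\mu_{\rm ss}$ (the dependence on $n$ is suppressed). *)

theory Defs
  imports "HOL-Probability.Probability"
begin

text \<open>
  A configuration is a pair \<open>(r, p)\<close> of stretches \<open>r\<^sub>1, \<dots>, r\<^sub>n\<close> and momenta \<open>p\<^sub>0, \<dots>, p\<^sub>n\<close>.  Since \<open>n\<close>
  tends to infinity in the limit, the dimension cannot be a type; both components are
  extensional functions on their index sets.
\<close>

type_synonym config = "(nat \<Rightarrow> real) \<times> (nat \<Rightarrow> real)"

definition Omega :: "nat \<Rightarrow> config set" where
  "Omega n = ({1..n} \<rightarrow>\<^sub>E UNIV) \<times> ({0..n} \<rightarrow>\<^sub>E UNIV)"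

definition config_borel :: "nat \<Rightarrow> config measure" where
  "config_borel n = PiM {1..n} (\<lambda>_. borel) \<Otimes>\<^sub>M PiM {0..n} (\<lambda>_. borel)"

definition d_r :: "nat \<Rightarrow> (config \<Rightarrow> real) \<Rightarrow> config \<Rightarrow> real" where
  "d_r x f = (\<lambda>(r, p). deriv (\<lambda>t. f (r(x := t), p)) (r x))"

definition d_p :: "nat \<Rightarrow> (config \<Rightarrow> real) \<Rightarrow> config \<Rightarrow> real" where
  "d_p x f = (\<lambda>(r, p). deriv (\<lambda>t. f (r, p(x := t))) (p x))"

definition gen_A :: "real \<Rightarrow> nat \<Rightarrow> (config \<Rightarrow> real) \<Rightarrow> config \<Rightarrow> real" where
  "gen_A \<tau> n f = (\<lambda>(r, p).
     (\<Sum>x = 1..n. (p x - p (x - 1)) * d_r x f (r, p))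
   + (\<Sum>x = 1..<n. (r (x + 1) - r x) * d_p x f (r, p))
   + r 1 * d_p 0 f (r, p)
   + (\<tau> - r n) * d_p n f (r, p))"

definition rot :: "nat \<Rightarrow> (config \<Rightarrow> real) \<Rightarrow> config \<Rightarrow> real" where
  "rot x f = (\<lambda>(r, p). p (x + 1) * d_p x f (r, p) - p x * d_p (x + 1) f (r, p))"

definition gen_S :: "nat \<Rightarrow> (config \<Rightarrow> real) \<Rightarrow> config \<Rightarrow> real" where
  "gen_S n f = (\<lambda>\<omega>. \<Sum>x = 0..<n. rot x (rot x f) \<omega>)"

definition gen_bath :: "real \<Rightarrow> real \<Rightarrow> nat \<Rightarrow> (config \<Rightarrow> real) \<Rightarrow> config \<Rightarrow> real" where
  "gen_bath Tm Tp n f = (\<lambda>(r, p).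
     Tm * d_p 0 (d_p 0 f) (r, p) - p 0 * d_p 0 f (r, p)
   + Tp * d_p n (d_p n f) (r, p) - p n * d_p n f (r, p))"

definition generator ::
  "real \<Rightarrow> real \<Rightarrow> real \<Rightarrow> real \<Rightarrow> real \<Rightarrow> nat \<Rightarrow> (config \<Rightarrow> real) \<Rightarrow> config \<Rightarrow> real" where
  "generator \<gamma> \<gamma>' Tm Tp \<tau> n f = (\<lambda>\<omega>.
     real n ^ 2 * (gen_A \<tau> n f \<omega> + \<gamma> / 2 * gen_S n f \<omega> + \<gamma>' / 2 * gen_bath Tm Tp n f \<omega>))"

primrec C_k :: "nat \<Rightarrow> nat \<Rightarrow> (config \<Rightarrow> real) \<Rightarrow> bool" where
  "C_k n 0 f \<longleftrightarrow> continuous_on (Omega n) f"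
| "C_k n (Suc k) f \<longleftrightarrow> continuous_on (Omega n) f
     \<and> (\<forall>x\<in>{1..n}. (\<forall>(r, p)\<in>Omega n. (\<lambda>t. f (r(x := t), p)) differentiable at (r x))
                     \<and> C_k n k (d_r x f))
     \<and> (\<forall>x\<in>{0..n}. (\<forall>(r, p)\<in>Omega n. (\<lambda>t. f (r, p(x := t))) differentiable at (p x))
                     \<and> C_k n k (d_p x f))"

definition test_function :: "nat \<Rightarrow> (config \<Rightarrow> real) \<Rightarrow> bool" where
  "test_function n f \<longleftrightarrow> C_k n 2 f \<and> (\<exists>K\<subseteq>Omega n. compact K \<and> (\<forall>\<omega>\<in>Omega n - K. f \<omega> = 0))"

text \<open>
  The diffusion with a given generator is understood in the sense of Stroock and Varadhan: a
  probability measure on the space of continuous paths in \<open>Omega n\<close>, with the \<open>\<sigma>\<close>-algebra of the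
  coordinate maps, that solves the martingale problem for the generator on \<open>C\<^sup>2\<close> functions of
  compact support.
\<close>

definition paths :: "nat \<Rightarrow> (real \<Rightarrow> config) set" where
  "paths n = {X \<in> {0..} \<rightarrow>\<^sub>E Omega n. continuous_on {0..} X}"

definition path_borel :: "nat \<Rightarrow> (real \<Rightarrow> config) measure" where
  "path_borel n = restrict_space (PiM {0..} (\<lambda>_. config_borel n)) (paths n)"

definition past :: "nat \<Rightarrow> real \<Rightarrow> (real \<Rightarrow> config) measure" where
  "past n s = vimage_algebra (paths n) (\<lambda>X. restrict X {0..s}) (PiM {0..s} (\<lambda>_. config_borel n))"

definition martingale_on :: "(real \<Rightarrow> config) measure \<Rightarrow> (real \<Rightarrow> (real \<Rightarrow> config) measure) \<Rightarrow>
    (real \<Rightarrow> (real \<Rightarrow> config) \<Rightarrow> real) \<Rightarrow> bool" where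
  "martingale_on P \<F> M \<longleftrightarrow>
     (\<forall>t\<ge>0. M t \<in> borel_measurable (\<F> t) \<and> integrable P (M t))
   \<and> (\<forall>s t. 0 \<le> s \<and> s \<le> t \<longrightarrow> (AE X in P. real_cond_exp P (\<F> s) (M t) X = M s X))"

definition diffusion_law ::
  "nat \<Rightarrow> ((config \<Rightarrow> real) \<Rightarrow> config \<Rightarrow> real) \<Rightarrow> (real \<Rightarrow> config) measure \<Rightarrow> bool" where
  "diffusion_law n L P \<longleftrightarrow>
     prob_space P \<and> sets P = sets (path_borel n)
   \<and> (\<forall>f. test_function n f \<longrightarrow>
        martingale_on P (past n) (\<lambda>t X. f (X t) - integral {0..t} (\<lambda>s. L f (X s))))"

text \<open>
  A probability measure is stationary if the diffusion started from it has that law at all times.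
\<close>

definition stationary_measure ::
  "nat \<Rightarrow> ((config \<Rightarrow> real) \<Rightarrow> config \<Rightarrow> real) \<Rightarrow> config measure \<Rightarrow> bool" where
  "stationary_measure n L \<mu> \<longleftrightarrow>
     prob_space \<mu> \<and> sets \<mu> = sets (config_borel n)
   \<and> (\<exists>P. diffusion_law n L P \<and> (\<forall>t\<ge>0. distr P (config_borel n) (\<lambda>X. X t) = \<mu>))"

definition finite_second_moments :: "nat \<Rightarrow> config measure \<Rightarrow> bool" where
  "finite_second_moments n \<mu> \<longleftrightarrow>
     (\<forall>x\<in>{1..n}. integrable \<mu> (\<lambda>(r, p). (r x)\<^sup>2)) \<and> (\<forall>x\<in>{0..n}. integrable \<mu> (\<lambda>(r, p). (p x)\<^sup>2))"

definition r_ss :: "real \<Rightarrow> real \<Rightarrow> real" where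
  "r_ss \<tau> u = \<tau> * u"

end

theory Submission
  imports Defs
begin

text \<open>
  Applied to the coordinates \<open>r\<^sub>x\<close> and \<open>p\<^sub>x\<close>, the generator gives affine functions, since
  \<open>S p\<^sub>x = - 2 p\<^sub>x\<close> in the bulk and \<open>- p\<^sub>x\<close> at the two ends.  Stationarity thus yields a closed linear
  system for the means: \<open>\<langle>p\<^sub>x\<rangle> = c\<close> is constant, and \<open>\<langle>r\<^sub>x\<^sub>+\<^sub>1\<rangle> - \<langle>r\<^sub>x\<rangle> = \<gamma> c\<close> with boundary conditions
  \<open>\<langle>r\<^sub>1\<rangle> = \<tau> - \<langle>r\<^sub>n\<rangle> = (\<gamma> + \<gamma>') c / 2\<close>.  Hence \<open>c = \<tau> / (n \<gamma> + \<gamma>')\<close>, and the profile is affine in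
  \<open>x\<close> up to an error of order \<open>1 / n\<close>.  The coordinates are not test functions; they are multiplied
  by \<open>(1 - e q)\<^sub>+\<^sup>3\<close>, where \<open>q\<close> is the sum of the squares of all coordinates, and \<open>e \<rightarrow> 0\<close> is taken by
  dominated convergence, using the second moments.
\<close>

section \<open>Stationary measures annihilate the generator\<close>

lemma space_config_borel: "space (config_borel n) = Omega n"
  by (simp add: config_borel_def Omega_def space_pair_measure space_PiM)

lemma space_path_borel: "space (path_borel n) = paths n"
  by (auto simp: path_borel_def space_restrict_space space_PiM space_config_borel paths_def)

lemma measurable_eval_path_borel:
  "t \<ge> 0 \<Longrightarrow> (\<lambda>X. X t) \<in> measurable (path_borel n) (config_borel n)"
  unfolding path_borel_def by (intro measurable_restrict_space1 measurable_component_singleton) simp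

text \<open>The conditional expectation in \<open>martingale_on\<close> has its usual properties
  only for a sub-sigma-algebra of \<open>P\<close>. Restriction of paths to \<open>{0..s}\<close> is
  measurable because every coordinate map is.\<close>

lemma subalgebra_past:
  assumes "sets P = sets (path_borel n)" "s \<ge> 0"
  shows "subalgebra P (past n s)"
proof -
  have sp: "space P = paths n"
    using sets_eq_imp_space_eq[OF assms(1)] by (simp add: space_path_borel)
  have "(\<lambda>X. restrict X {0..s}) \<in> measurable (path_borel n) (PiM {0..s} (\<lambda>_. config_borel n))"
    using assms(2) by (intro measurable_restrict measurable_eval_path_borel) simp
  then have "(\<lambda>X. restrict X {0..s}) -` B \<inter> paths n \<in> sets P"
    if "B \<in> sets (PiM {0..s} (\<lambda>_. config_borel n))" for B
    using measurable_sets[OF _ that] assms(1) by (metis space_path_borel)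
  moreover have "(\<lambda>X. restrict X {0..s}) \<in> paths n \<rightarrow> space (PiM {0..s} (\<lambda>_. config_borel n))"
    using assms(2) by (fastforce simp: paths_def space_PiM space_config_borel)
  ultimately show ?thesis
    by (auto simp: subalgebra_def sp past_def space_vimage_algebra sets_vimage_algebra2)
qed

text \<open>Conditional expectation preserves the integral, so it is enough to integrate the
  martingale identity conditioned on the past at time 0.\<close>

lemma martingale_on_expectation:
  assumes "prob_space P" "sets P = sets (path_borel n)" "martingale_on P (past n) M" "t \<ge> 0"
  shows "(\<integral>X. M t X \<partial>P) = (\<integral>X. M 0 X \<partial>P)"
proof -
  interpret prob_space P by fact
  interpret finite_measure_subalgebra P "past n 0"
    by unfold_locales (use subalgebra_past[OF assms(2)] in simp)
  have M: "integrable P (M t)" "AE X in P. real_cond_exp P (past n 0) (M t) X = M 0 X"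
    and M0: "integrable P (M 0)"
    using assms(3,4) by (auto simp: martingale_on_def)
  have "(\<integral>X. M t X \<partial>P) = (\<integral>X. real_cond_exp P (past n 0) (M t) X \<partial>P)"
    using real_cond_exp_int(2)[OF M(1)] by simp
  also have "\<dots> = (\<integral>X. M 0 X \<partial>P)"
    using M M0 by (intro integral_cong_AE) auto
  finally show ?thesis .
qed

text \<open>Differentiating the vanishing expectation of \<open>\<integral>\<^sub>0\<^sup>t L f (X\<^sub>s) ds\<close> at \<open>t = 0\<close> avoids
  Fubini, hence joint measurability of the integrand.\<close>

lemma stationary_measure_integral_generator:
  assumes "stationary_measure n L \<mu>" "test_function n f" "continuous_on (Omega n) (L f)"
    and "bounded (L f ` Omega n)" "L f \<in> borel_measurable (config_borel n)"
    and "f \<in> borel_measurable (config_borel n)" "bounded (f ` Omega n)"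
  shows "(\<integral>\<omega>. L f \<omega> \<partial>\<mu>) = 0"
proof -
  obtain P where P: "diffusion_law n L P"
    and distr: "\<And>t. t \<ge> 0 \<Longrightarrow> distr P (config_borel n) (\<lambda>X. X t) = \<mu>"
    using assms(1) unfolding stationary_measure_def by blast
  have prob: "prob_space P" and sets: "sets P = sets (path_borel n)"
    and mart: "martingale_on P (past n) (\<lambda>t X. f (X t) - integral {0..t} (\<lambda>s. L f (X s)))"
    using P assms(2) by (auto simp: diffusion_law_def)
  interpret prob_space P by fact
  have space: "space P = paths n"
    using sets_eq_imp_space_eq[OF sets] by (simp add: space_path_borel)
  have eval[measurable]: "(\<lambda>X. X t) \<in> measurable P (config_borel n)" if "t \<ge> 0" for t
    using measurable_eval_path_borel[OF that] measurable_cong_sets[OF sets refl] by blast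
  obtain B where B: "\<And>\<omega>. \<omega> \<in> Omega n \<Longrightarrow> \<bar>L f \<omega>\<bar> \<le> B"
    using assms(4) unfolding bounded_iff by (metis image_eqI real_norm_def)
  obtain B' where B': "\<And>\<omega>. \<omega> \<in> Omega n \<Longrightarrow> \<bar>f \<omega>\<bar> \<le> B'"
    using assms(7) unfolding bounded_iff by (metis image_eqI real_norm_def)
  have in_Omega: "X t \<in> Omega n" if "X \<in> space P" "t \<ge> 0" for X t
    using that by (auto simp: space paths_def)
  define J where "J t X = integral {0..t} (\<lambda>s. L f (X s))" for t and X :: "real \<Rightarrow> config"
  have cont: "continuous_on {0..} (\<lambda>s. L f (X s))" if "X \<in> space P" for X
    using that in_Omega[OF that]
    by (intro continuous_on_compose2[OF assms(3)]) (auto simp: space paths_def)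
  have f_int: "integrable P (\<lambda>X. f (X t))" if "t \<ge> 0" for t
    using that assms(6) eval[OF that] B' in_Omega
    by (intro integrable_const_bound[of _ B'] AE_I2) (auto intro: measurable_compose)
  have f_expect: "(\<integral>X. f (X t) \<partial>P) = (\<integral>\<omega>. f \<omega> \<partial>\<mu>)" if "t \<ge> 0" for t
    using integral_distr[OF eval[OF that] assms(6)] distr[OF that] by simp
  \<comment> \<open>As the difference of \<open>f (X t)\<close> and the martingale,
    \<open>J t\<close> inherits measurability and integrability from these two.\<close>
  have J_int: "integrable P (J t)" if "t \<ge> 0" for t
  proof -
    have "integrable P (\<lambda>X. f (X t) - J t X)"
      using mart that by (simp add: martingale_on_def J_def)
    from Bochner_Integration.integrable_diff[OF f_int[OF that] this] show ?thesis by simp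
  qed
  \<comment> \<open>By stationarity \<open>f (X t)\<close> and \<open>f (X 0)\<close> have the same
    mean, so the constant mean of the martingale forces that of \<open>J t\<close> to
    vanish.\<close>
  have J_zero: "(\<integral>X. J t X \<partial>P) = 0" if "t \<ge> 0" for t
  proof -
    have "(\<integral>X. f (X t) - J t X \<partial>P) = (\<integral>X. f (X 0) \<partial>P)"
      using martingale_on_expectation[OF prob sets mart that] by (simp add: J_def)
    then show ?thesis
      using Bochner_Integration.integral_diff[OF f_int[OF that] J_int[OF that]] f_expect[OF that]
        f_expect[of 0] by simp
  qed
  \<comment> \<open>Times in \<open>(0, 1]\<close> tending to 0. They turn the one-sided derivative
    of \<open>J\<close> at 0 into a limit along a sequence, to which dominated convergence
    applies.\<close>
  define h where "h k = inverse (real (Suc k))" for k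
  have h: "h k > 0" "h k \<le> 1" for k
    by (simp_all add: h_def field_simps)
  have "(\<lambda>k. \<integral>X. J (h k) X / h k \<partial>P) \<longlonglongrightarrow> (\<integral>X. L f (X 0) \<partial>P)"
  proof (rule integral_dominated_convergence)
    show "(\<lambda>X. L f (X 0)) \<in> borel_measurable P"
      using measurable_compose[OF eval assms(5)] by simp
    show "(\<lambda>X. J (h k) X / h k) \<in> borel_measurable P" for k
      using J_int[of "h k"] h(1)[of k] by (auto intro!: borel_measurable_divide)
    show "integrable P (\<lambda>_. B)"
      by simp
    show "AE X in P. (\<lambda>k. J (h k) X / h k) \<longlonglongrightarrow> L f (X 0)"
    proof (rule AE_I2)
      fix X assume X: "X \<in> space P"
      have "((\<lambda>t. J t X) has_real_derivative L f (X 0)) (at 0 within {0..1})"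
        unfolding J_def
        by (rule integral_has_real_derivative) (auto intro: continuous_on_subset[OF cont[OF X]])
      then have "((\<lambda>t. J t X / t) \<longlongrightarrow> L f (X 0)) (at 0 within {0..1})"
        by (simp add: has_field_derivative_iff J_def)
      moreover have "filterlim h (at 0 within {0..1}) sequentially"
        unfolding filterlim_at using h LIMSEQ_inverse_real_of_nat
        by (auto simp: h_def[abs_def] less_imp_le intro!: always_eventually)
      ultimately show "(\<lambda>k. J (h k) X / h k) \<longlonglongrightarrow> L f (X 0)"
        by (rule filterlim_compose)
    qed
    show "AE X in P. norm (J (h k) X / h k) \<le> B" for k
    proof (rule AE_I2)
      fix X assume X: "X \<in> space P"
      have "norm (J (h k) X) \<le> B * (h k - 0)"
        unfolding J_def using h(1)[of k] B in_Omega[OF X]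
        by (intro integral_bound continuous_on_subset[OF cont[OF X]]) auto
      then show "norm (J (h k) X / h k) \<le> B"
        using h(1)[of k] by (simp add: field_simps)
    qed
  qed
  moreover have "(\<integral>X. J (h k) X / h k \<partial>P) = 0" for k
    using J_zero[of "h k"] h(1)[of k] by simp
  ultimately have "(\<integral>X. L f (X 0) \<partial>P) = 0"
    by (simp only: LIMSEQ_const_iff)
  then show ?thesis
    using integral_distr[OF eval assms(5), of 0] distr[of 0] by simp
qed

section \<open>Truncated coordinates as test functions\<close>

fun coord :: "nat + nat \<Rightarrow> config \<Rightarrow> real" where
  "coord (Inl x) \<omega> = fst \<omega> x"
| "coord (Inr x) \<omega> = snd \<omega> x"

fun coord_upd :: "nat + nat \<Rightarrow> real \<Rightarrow> config \<Rightarrow> config" where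
  "coord_upd (Inl x) t \<omega> = ((fst \<omega>)(x := t), snd \<omega>)"
| "coord_upd (Inr x) t \<omega> = (fst \<omega>, (snd \<omega>)(x := t))"

abbreviation coords :: "nat \<Rightarrow> (nat + nat) set" where
  "coords n \<equiv> {1..n} <+> {0..n}"

text \<open>The derivative is demanded at every pair of functions, not just on
  \<open>Omega n\<close>. Then \<open>d_r x f\<close> and \<open>d_p x f\<close> equal
  \<open>f'\<close> as functions, so that iterated derivatives in the generator can be rewritten one
  after the other.\<close>

definition has_partial :: "nat + nat \<Rightarrow> (config \<Rightarrow> real) \<Rightarrow> (config \<Rightarrow> real) \<Rightarrow> bool" where
  "has_partial i f f' \<longleftrightarrow>
     (\<forall>\<omega>. ((\<lambda>t. f (coord_upd i t \<omega>)) has_real_derivative f' \<omega>) (at (coord i \<omega>)))"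

lemma has_partialD:
  "has_partial i f f' \<Longrightarrow> ((\<lambda>t. f (coord_upd i t \<omega>)) has_real_derivative f' \<omega>) (at (coord i \<omega>))"
  by (simp only: has_partial_def)

lemma coord_upd_coord [simp]: "coord_upd i (coord i \<omega>) \<omega> = \<omega>"
  by (cases i) auto

lemma coord_coord_upd: "coord j (coord_upd i t \<omega>) = (if i = j then t else coord j \<omega>)"
  by (cases i; cases j) auto

lemma d_r_eq: "has_partial (Inl x) f f' \<Longrightarrow> d_r x f = f'"
  by (fastforce simp: has_partial_def d_r_def fun_eq_iff intro!: DERIV_imp_deriv)

lemma d_p_eq: "has_partial (Inr x) f f' \<Longrightarrow> d_p x f = f'"
  by (fastforce simp: has_partial_def d_p_def fun_eq_iff intro!: DERIV_imp_deriv)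

lemma has_partial_eq_rhs: "has_partial i f f' \<Longrightarrow> (\<And>\<omega>. f' \<omega> = g \<omega>) \<Longrightarrow> has_partial i f g"
  by (simp add: has_partial_def)

lemma has_partial_const: "has_partial i (\<lambda>_. c) (\<lambda>_. 0)"
  by (simp add: has_partial_def)

lemma has_partial_coord: "has_partial i (coord j) (\<lambda>_. of_bool (i = j))"
  by (simp add: has_partial_def coord_coord_upd)

lemma has_partial_add:
  "has_partial i f f' \<Longrightarrow> has_partial i g g' \<Longrightarrow>
    has_partial i (\<lambda>\<omega>. f \<omega> + g \<omega>) (\<lambda>\<omega>. f' \<omega> + g' \<omega>)"
  by (simp add: has_partial_def DERIV_add)

lemma has_partial_mult:
  assumes "has_partial i f f'" "has_partial i g g'"
  shows "has_partial i (\<lambda>\<omega>. f \<omega> * g \<omega>) (\<lambda>\<omega>. f' \<omega> * g \<omega> + g' \<omega> * f \<omega>)"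
  unfolding has_partial_def
proof
  fix \<omega>
  show "((\<lambda>t. f (coord_upd i t \<omega>) * g (coord_upd i t \<omega>)) has_real_derivative
      f' \<omega> * g \<omega> + g' \<omega> * f \<omega>) (at (coord i \<omega>))"
    using DERIV_mult[OF assms[THEN has_partialD, of \<omega>]] by simp
qed

section \<open>The cutoff and its derivatives\<close>

definition sqnorm :: "nat \<Rightarrow> config \<Rightarrow> real" where
  "sqnorm n \<omega> = (\<Sum>i\<in>coords n. (coord i \<omega>)\<^sup>2)"

text \<open>Derivatives of powers of this positive part are again coordinates times powers of it, so
  all error terms in the generator stay explicit.\<close>

definition cutoff :: "nat \<Rightarrow> real \<Rightarrow> config \<Rightarrow> real" where
  "cutoff n e \<omega> = max 0 (1 - e * sqnorm n \<omega>)"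

lemma cutoff_nonneg: "0 \<le> cutoff n e \<omega>"
  by (simp add: cutoff_def)

lemma coord_sq_le_sqnorm: "i \<in> coords n \<Longrightarrow> (coord i \<omega>)\<^sup>2 \<le> sqnorm n \<omega>"
  unfolding sqnorm_def by (rule member_le_sum) auto

lemma sqnorm_nonneg: "0 \<le> sqnorm n \<omega>"
  unfolding sqnorm_def by (rule sum_nonneg) auto

lemma cutoff_le_1: "e \<ge> 0 \<Longrightarrow> cutoff n e \<omega> \<le> 1"
  by (simp add: cutoff_def sqnorm_nonneg)

lemma has_real_derivative_pos_part_power:
  "((\<lambda>s::real. max 0 s ^ Suc (Suc k)) has_real_derivative real (Suc (Suc k)) * max 0 s ^ Suc k) (at s)"
proof -
  consider "s > 0" | "s < 0" | "s = 0" by linarith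
  then show ?thesis
  proof cases
    case 1
    have "((\<lambda>s::real. s ^ Suc (Suc k)) has_real_derivative real (Suc (Suc k)) * max 0 s ^ Suc k) (at s)"
      using 1 DERIV_pow[of "Suc (Suc k)" s UNIV] by (simp del: power_Suc)
    then show ?thesis
      by (rule has_field_derivative_transform_within_open[where S="{0<..}"]) (use 1 in auto)
  next
    case 2
    have "((\<lambda>s::real. 0) has_real_derivative real (Suc (Suc k)) * max 0 s ^ Suc k) (at s)"
      using 2 by (auto intro!: derivative_eq_intros simp: max_def)
    then show ?thesis
      by (rule has_field_derivative_transform_within_open[where S="{..<0}"]) (use 2 in auto)
  next
    \<comment> \<open>At the corner the difference quotient equals \<open>max 0 h ^ Suc k\<close>
      for nonzero \<open>h\<close>, and the positive exponent sends it to 0.\<close>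
    case 3
    have "((\<lambda>h::real. max 0 h ^ Suc k) \<longlongrightarrow> max 0 0 ^ Suc k) (at 0)"
      by (intro tendsto_intros)
    then have "((\<lambda>h::real. max 0 h ^ Suc k) \<longlongrightarrow> 0) (at 0)"
      by simp
    then have "((\<lambda>h::real. max 0 h ^ Suc (Suc k) / h) \<longlongrightarrow> 0) (at 0)"
      by (rule Lim_transform_eventually)
        (auto simp: eventually_at_filter max_def intro!: always_eventually)
    then show ?thesis
      using 3 by (simp add: has_field_derivative_iff)
  qed
qed

lemma sqnorm_upd:
  assumes "i \<in> coords n"
  shows "sqnorm n (coord_upd i t \<omega>) = sqnorm n \<omega> - (coord i \<omega>)\<^sup>2 + t\<^sup>2"
proof -
  have "sqnorm n (coord_upd i t \<omega>) = t\<^sup>2 + (\<Sum>j\<in>coords n - {i}. (coord j \<omega>)\<^sup>2)"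
    unfolding sqnorm_def
    by (subst sum.remove[OF _ assms]) (auto simp: coord_coord_upd simp del: coord.simps intro!: sum.cong split: if_splits)
  moreover have "sqnorm n \<omega> = (coord i \<omega>)\<^sup>2 + (\<Sum>j\<in>coords n - {i}. (coord j \<omega>)\<^sup>2)"
    unfolding sqnorm_def using assms by (intro sum.remove) auto
  ultimately show ?thesis by simp
qed

text \<open>Along a single coordinate \<open>sqnorm\<close> is a square plus a constant, by
  \<open>sqnorm_upd\<close>, so this is the chain rule for a power of a positive part.\<close>

lemma has_partial_cutoff_power:
  assumes "i \<in> coords n"
  shows "has_partial i (\<lambda>\<omega>. cutoff n e \<omega> ^ Suc (Suc k))
    (\<lambda>\<omega>. - 2 * real (Suc (Suc k)) * e * coord i \<omega> * cutoff n e \<omega> ^ Suc k)"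
  unfolding has_partial_def
proof
  fix \<omega>
  have "((\<lambda>t. 1 - e * (sqnorm n \<omega> - (coord i \<omega>)\<^sup>2 + t\<^sup>2)) has_real_derivative
      - 2 * e * coord i \<omega>) (at (coord i \<omega>))"
    by (auto intro!: derivative_eq_intros)
  from DERIV_chain2[OF has_real_derivative_pos_part_power this, of k]
  have "((\<lambda>t. cutoff n e (coord_upd i t \<omega>) ^ Suc (Suc k)) has_real_derivative
      real (Suc (Suc k)) * cutoff n e \<omega> ^ Suc k * (- 2 * e * coord i \<omega>)) (at (coord i \<omega>))"
    unfolding cutoff_def sqnorm_upd[OF assms] by (simp del: power_Suc of_nat_Suc)
  then show "((\<lambda>t. cutoff n e (coord_upd i t \<omega>) ^ Suc (Suc k)) has_real_derivative
      - 2 * real (Suc (Suc k)) * e * coord i \<omega> * cutoff n e \<omega> ^ Suc k) (at (coord i \<omega>))"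
    by (rule DERIV_cong) (simp only: mult_ac mult_minus_left mult_minus_right)
qed

text \<open>A relational counterpart of \<open>C_k\<close> on all pairs of functions: derivatives
  are witnesses instead of values of \<open>deriv\<close>, which makes induction through the sum and
  product rules direct.\<close>

primrec smooth :: "nat \<Rightarrow> nat \<Rightarrow> (config \<Rightarrow> real) \<Rightarrow> bool" where
  "smooth n 0 f \<longleftrightarrow> continuous_on UNIV f"
| "smooth n (Suc k) f \<longleftrightarrow> continuous_on UNIV f \<and>
     (\<forall>i\<in>coords n. \<exists>f'. has_partial i f f' \<and> smooth n k f')"

lemma smooth_SucD:
  "smooth n (Suc k) f \<Longrightarrow> i \<in> coords n \<Longrightarrow> \<exists>f'. has_partial i f f' \<and> smooth n k f'"
  unfolding smooth.simps(2) by (drule conjunct2) (rule bspec)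

lemma smooth_continuous: "smooth n k f \<Longrightarrow> continuous_on UNIV f"
  by (cases k) auto

text \<open>Needed for products: the product rule leaves one factor undifferentiated, and that
  factor must be used at the lower order.\<close>

lemma smooth_Suc_imp: "smooth n (Suc k) f \<Longrightarrow> smooth n k f"
proof (induction k arbitrary: f)
  case 0
  then show ?case by simp
next
  case (Suc k)
  have "\<exists>f'. has_partial i f f' \<and> smooth n k f'" if i: "i \<in> coords n" for i
  proof -
    obtain f' where "has_partial i f f'" "smooth n (Suc k) f'"
      using smooth_SucD[OF Suc.prems i] by blast
    then show ?thesis using Suc.IH by blast
  qed
  then show ?case using Suc.prems by simp
qed

text \<open>Derivatives are unique, so the witnesses in \<open>smooth\<close> coincide with
  \<open>d_r x f\<close> and \<open>d_p x f\<close>.\<close>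

lemma smooth_imp_C_k: "smooth n k f \<Longrightarrow> C_k n k f"
proof (induction k arbitrary: f)
  case 0
  then show ?case by (auto intro: continuous_on_subset)
next
  case (Suc k)
  have "(\<forall>(r, p)\<in>Omega n. (\<lambda>t. f (r(x := t), p)) differentiable at (r x)) \<and> C_k n k (d_r x f)"
    if x: "x \<in> {1..n}" for x
  proof -
    obtain f' where f': "has_partial (Inl x) f f'" "smooth n k f'"
      using smooth_SucD[OF Suc.prems InlI[OF x]] by blast
    then show ?thesis
      using Suc.IH[OF f'(2)] by (force simp: d_r_eq[OF f'(1)] has_partial_def real_differentiable_def)
  qed
  moreover have "(\<forall>(r, p)\<in>Omega n. (\<lambda>t. f (r, p(x := t))) differentiable at (p x)) \<and> C_k n k (d_p x f)"
    if x: "x \<in> {0..n}" for x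
  proof -
    obtain f' where f': "has_partial (Inr x) f f'" "smooth n k f'"
      using smooth_SucD[OF Suc.prems InrI[OF x]] by blast
    then show ?thesis
      using Suc.IH[OF f'(2)] by (force simp: d_p_eq[OF f'(1)] has_partial_def real_differentiable_def)
  qed
  ultimately show ?case
    using smooth_continuous[OF Suc.prems] by (auto intro: continuous_on_subset)
qed

lemma continuous_on_coord: "continuous_on S (coord i)"
proof (cases i)
  case (Inl x)
  have "continuous_on S (\<lambda>\<omega>. fst \<omega> x)"
    by (rule continuous_on_compose2[OF continuous_on_product_coordinates continuous_on_fst[OF continuous_on_id]]) simp
  then show ?thesis using Inl by (simp add: coord.simps[abs_def])
next
  case (Inr x)
  have "continuous_on S (\<lambda>\<omega>. snd \<omega> x)"
    by (rule continuous_on_compose2[OF continuous_on_product_coordinates continuous_on_snd[OF continuous_on_id]]) simp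
  then show ?thesis using Inr by (simp add: coord.simps[abs_def])
qed

lemma continuous_on_cutoff: "continuous_on S (cutoff n e)"
  unfolding cutoff_def[abs_def] sqnorm_def
  by (intro continuous_intros continuous_on_coord)

lemma smooth_const: "smooth n k (\<lambda>_. c)"
  by (induction k arbitrary: c) (auto intro: has_partial_const)

lemma smooth_coord: "smooth n k (coord j)"
  by (cases k) (auto intro: continuous_on_coord has_partial_coord smooth_const)

lemma smooth_add: "smooth n k f \<Longrightarrow> smooth n k g \<Longrightarrow> smooth n k (\<lambda>\<omega>. f \<omega> + g \<omega>)"
proof (induction k arbitrary: f g)
  case 0
  then show ?case by (auto intro: continuous_on_add)
next
  case (Suc k)
  then show ?case
    by (fastforce intro: has_partial_add continuous_on_add)
qed

lemma smooth_mult: "smooth n k f \<Longrightarrow> smooth n k g \<Longrightarrow> smooth n k (\<lambda>\<omega>. f \<omega> * g \<omega>)"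
proof (induction k arbitrary: f g)
  case 0
  then show ?case by (auto intro: continuous_on_mult)
next
  case (Suc k)
  have "\<exists>h'. has_partial i (\<lambda>\<omega>. f \<omega> * g \<omega>) h' \<and> smooth n k h'" if i: "i \<in> coords n" for i
  proof -
    obtain f' g' where f': "has_partial i f f'" "smooth n k f'"
      and g': "has_partial i g g'" "smooth n k g'"
      using Suc.prems[THEN smooth_SucD, OF i] by blast
    have "smooth n k (\<lambda>\<omega>. f' \<omega> * g \<omega> + g' \<omega> * f \<omega>)"
      using f'(2) g'(2) Suc.prems[THEN smooth_Suc_imp] by (intro smooth_add Suc.IH)
    with has_partial_mult[OF f'(1) g'(1)] show ?thesis
      by (intro exI conjI)
  qed
  then show ?case
    using Suc.prems by (auto intro: continuous_on_mult)
qed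

text \<open>Each derivative costs one power of the cutoff and produces a coordinate factor. With
  \<open>k + 1\<close> powers at least one is left after \<open>k\<close> derivatives, and it is
  continuous.\<close>

lemma smooth_cutoff_power: "smooth n k (\<lambda>\<omega>. cutoff n e \<omega> ^ Suc (k + l))"
proof (induction k arbitrary: l)
  case 0
  then show ?case by (auto intro!: continuous_intros continuous_on_cutoff)
next
  case (Suc k)
  have "smooth n k (\<lambda>\<omega>. - 2 * real (Suc (Suc (k + l))) * e * coord i \<omega> * cutoff n e \<omega> ^ Suc (k + l))" for i
    by (intro smooth_mult smooth_const smooth_coord Suc.IH)
  then show ?case
    using has_partial_cutoff_power[of _ n e "k + l"]
    by (auto intro!: continuous_intros continuous_on_cutoff simp del: power_Suc) 
qed

text \<open>Three powers are what \<open>smooth_cutoff_power\<close> asks for two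
  derivatives.\<close>

definition trunc_coord :: "nat \<Rightarrow> real \<Rightarrow> nat + nat \<Rightarrow> config \<Rightarrow> real" where
  "trunc_coord n e j \<omega> = coord j \<omega> * cutoff n e \<omega> ^ 3"

lemma smooth_trunc_coord: "smooth n 2 (trunc_coord n e j)"
  unfolding trunc_coord_def[abs_def]
  using smooth_cutoff_power[of n 2 e 0] by (intro smooth_mult smooth_coord) (simp add: numeral_3_eq_3)

section \<open>Compact support of the truncated coordinates\<close>

definition cube :: "nat \<Rightarrow> real \<Rightarrow> config set" where
  "cube n b = ({1..n} \<rightarrow>\<^sub>E {-b..b}) \<times> ({0..n} \<rightarrow>\<^sub>E {-b..b})"

text \<open>Extensional functions take the value \<open>undefined\<close> off \<open>I\<close>, so
  the set is a full product with singleton factors there, and Tychonoff's theorem applies.\<close>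

lemma compact_PiE_const:
  fixes S :: "'b::topological_space set"
  assumes "compact S"
  shows "compact (I \<rightarrow>\<^sub>E S)"
proof -
  have "I \<rightarrow>\<^sub>E S = (\<Pi>\<^sub>E i\<in>UNIV. if i \<in> I then S else {undefined})"
    by (auto simp: PiE_def extensional_def Pi_def split: if_splits)
  moreover have "compactin (product_topology (\<lambda>_. euclidean) UNIV) (\<Pi>\<^sub>E i\<in>UNIV. if i \<in> I then S else {undefined})"
    using assms by (auto simp: compactin_PiE)
  ultimately show ?thesis
    by (simp add: euclidean_product_topology)
qed

lemma cube: "cube n b \<subseteq> Omega n" "compact (cube n b)"
  unfolding cube_def Omega_def by (auto intro!: compact_Times compact_PiE_const)

lemma cutoff_eq_0_outside_cube:
  assumes "\<omega> \<in> Omega n - cube n (1 / e)" "0 < e" "e \<le> 1"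
  shows "cutoff n e \<omega> = 0"
proof (rule ccontr)
  assume "cutoff n e \<omega> \<noteq> 0"
  then have "e * sqnorm n \<omega> < 1" by (auto simp: cutoff_def max_def split: if_splits)
  then have q: "sqnorm n \<omega> \<le> 1 / e" using assms by (simp add: field_simps)
  have "\<bar>coord i \<omega>\<bar> \<le> 1 / e" if "i \<in> coords n" for i
  proof -
    have "(coord i \<omega>)\<^sup>2 \<le> 1 / e * 1" using coord_sq_le_sqnorm[OF that, of \<omega>] q by simp
    \<comment> \<open>The natural radius is the square root of \<open>1 / e\<close>. Since
      \<open>e \<le> 1\<close>, it is at most \<open>1 / e\<close>, which serves as the side of the
      cube.\<close>
    also have "\<dots> \<le> 1 / e * (1 / e)" using assms by (intro mult_left_mono) auto
    finally show ?thesis using assms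
      by (metis abs_le_square_iff abs_of_pos divide_pos_pos less_numeral_extra(1) power2_eq_square)
  qed
  from this[OF InlI] this[OF InrI] have "\<omega> \<in> cube n (1 / e)"
    using assms(1) by (cases \<omega>) (auto simp: cube_def Omega_def PiE_iff abs_le_iff minus_le_iff)
  then show False using assms(1) by simp
qed

lemma test_function_trunc_coord:
  assumes "0 < e" "e \<le> 1"
  shows "test_function n (trunc_coord n e j)"
  unfolding test_function_def
proof (intro conjI exI)
  show "C_k n 2 (trunc_coord n e j)" by (rule smooth_imp_C_k[OF smooth_trunc_coord])
  show "cube n (1 / e) \<subseteq> Omega n" "compact (cube n (1 / e))" by (rule cube)+
  show "\<forall>\<omega>\<in>Omega n - cube n (1 / e). trunc_coord n e j \<omega> = 0"
    using cutoff_eq_0_outside_cube assms by (simp add: trunc_coord_def)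
qed

section \<open>The generator on truncated coordinates\<close>

lemma has_partial_cutoff_2_3:
  assumes "i \<in> coords n"
  shows "has_partial i (\<lambda>\<omega>. (cutoff n e \<omega>)\<^sup>2) (\<lambda>\<omega>. - 4 * e * coord i \<omega> * cutoff n e \<omega>)"
    and "has_partial i (\<lambda>\<omega>. cutoff n e \<omega> ^ 3) (\<lambda>\<omega>. - 6 * e * coord i \<omega> * (cutoff n e \<omega>)\<^sup>2)"
  using has_partial_cutoff_power[OF assms, of e 0] has_partial_cutoff_power[OF assms, of e 1]
  by (simp_all add: numeral_2_eq_2 numeral_3_eq_3)

text \<open>One rotation turns a truncated coordinate into a truncated linear form in two
  coordinates. This form has to be differentiated for the second rotation.\<close>

lemma has_partial_linear_cutoff:
  assumes "i \<in> coords n"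
  shows "has_partial i (\<lambda>\<omega>. (a * coord k \<omega> + b * coord l \<omega>) * cutoff n e \<omega> ^ 3)
    (\<lambda>\<omega>. (a * of_bool (i = k) + b * of_bool (i = l)) * cutoff n e \<omega> ^ 3
      - 6 * e * coord i \<omega> * (a * coord k \<omega> + b * coord l \<omega>) * (cutoff n e \<omega>)\<^sup>2)"
proof -
  have "has_partial i (\<lambda>\<omega>. (a * coord k \<omega> + b * coord l \<omega>) * cutoff n e \<omega> ^ 3) (\<lambda>\<omega>.
      ((0 * coord k \<omega> + of_bool (i = k) * a) + (0 * coord l \<omega> + of_bool (i = l) * b)) * cutoff n e \<omega> ^ 3
      + - 6 * e * coord i \<omega> * (cutoff n e \<omega>)\<^sup>2 * (a * coord k \<omega> + b * coord l \<omega>))"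
    by (intro has_partial_mult has_partial_add has_partial_const has_partial_coord
        has_partial_cutoff_2_3 assms)
  then show ?thesis
    by (rule has_partial_eq_rhs) (simp add: algebra_simps)
qed

lemma has_partial_trunc_coord:
  assumes "i \<in> coords n"
  shows "has_partial i (trunc_coord n e j)
    (\<lambda>\<omega>. of_bool (i = j) * cutoff n e \<omega> ^ 3 - 6 * e * coord j \<omega> * (cutoff n e \<omega>)\<^sup>2 * coord i \<omega>)"
  using has_partial_linear_cutoff[OF assms, of 1 j 0 j e]
  by (simp add: trunc_coord_def[abs_def] mult_ac)

lemma has_partial2_trunc_coord:
  assumes "i \<in> coords n"
  shows "has_partial i
    (\<lambda>\<omega>. of_bool (i = j) * cutoff n e \<omega> ^ 3 - 6 * e * coord j \<omega> * (cutoff n e \<omega>)\<^sup>2 * coord i \<omega>)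
    (\<lambda>\<omega>. - 12 * e * of_bool (i = j) * coord i \<omega> * (cutoff n e \<omega>)\<^sup>2
      - 6 * e * coord j \<omega> * (cutoff n e \<omega>)\<^sup>2 + 24 * e\<^sup>2 * (coord i \<omega>)\<^sup>2 * coord j \<omega> * cutoff n e \<omega>)"
proof -
  \<comment> \<open>Function and derivative are written in the exact shape that the sum and product
    rules produce. Algebra then brings both to the stated form.\<close>
  have "has_partial i
      (\<lambda>\<omega>. of_bool (i = j) * cutoff n e \<omega> ^ 3 + (- 6 * e) * ((coord j \<omega> * coord i \<omega>) * (cutoff n e \<omega>)\<^sup>2))
      (\<lambda>\<omega>. (0 * cutoff n e \<omega> ^ 3 + - 6 * e * coord i \<omega> * (cutoff n e \<omega>)\<^sup>2 * of_bool (i = j))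
        + (0 * ((coord j \<omega> * coord i \<omega>) * (cutoff n e \<omega>)\<^sup>2)
          + ((of_bool (i = j) * coord i \<omega> + of_bool (i = i) * coord j \<omega>) * (cutoff n e \<omega>)\<^sup>2
             + - 4 * e * coord i \<omega> * cutoff n e \<omega> * (coord j \<omega> * coord i \<omega>)) * (- 6 * e)))"
    by (intro has_partial_mult has_partial_add has_partial_const has_partial_coord
        has_partial_cutoff_2_3 assms)
  moreover have "of_bool (i = j) * cutoff n e \<omega> ^ 3 + (- 6 * e) * ((coord j \<omega> * coord i \<omega>) * (cutoff n e \<omega>)\<^sup>2)
      = of_bool (i = j) * cutoff n e \<omega> ^ 3 - 6 * e * coord j \<omega> * (cutoff n e \<omega>)\<^sup>2 * coord i \<omega>" for \<omega>
    by simp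
  ultimately show ?thesis
    by (simp only:) (erule has_partial_eq_rhs, cases "i = j"; simp add: power2_eq_square algebra_simps)
qed

text \<open>The first-order operator \<open>A\<close> as the pairing of its coefficient vector at
  \<open>\<omega>\<close> with a gradient \<open>v\<close>.\<close>

definition drift_form :: "real \<Rightarrow> nat \<Rightarrow> config \<Rightarrow> (nat + nat \<Rightarrow> real) \<Rightarrow> real" where
  "drift_form \<tau> n \<omega> v =
     (\<Sum>x = 1..n. (snd \<omega> x - snd \<omega> (x - 1)) * v (Inl x))
   + (\<Sum>x = 1..<n. (fst \<omega> (x + 1) - fst \<omega> x) * v (Inr x))
   + fst \<omega> 1 * v (Inr 0) + (\<tau> - fst \<omega> n) * v (Inr n)"

lemma drift_form_linear:
  "drift_form \<tau> n \<omega> (\<lambda>i. u i * c - d * v i) = c * drift_form \<tau> n \<omega> u - d * drift_form \<tau> n \<omega> v"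
  by (simp add: drift_form_def algebra_simps sum.distrib sum_subtractf sum_distrib_left)

text \<open>This is \<open>A\<close> applied to half of \<open>sqnorm\<close>, the energy: exchanges
  inside the chain telescope, and only the work of the boundary tension remains.\<close>

lemma drift_form_coord:
  assumes "n \<ge> 1"
  shows "drift_form \<tau> n \<omega> (\<lambda>i. coord i \<omega>) = \<tau> * snd \<omega> n"
proof -
  have "(\<Sum>x = 1..n. (snd \<omega> x - snd \<omega> (x - 1)) * fst \<omega> x)
      + (\<Sum>x = 1..<n. (fst \<omega> (x + 1) - fst \<omega> x) * snd \<omega> x) + fst \<omega> 1 * snd \<omega> 0 = fst \<omega> n * snd \<omega> n"
    using assms by (induction n rule: nat_induct_at_least) (auto simp: algebra_simps)
  then show ?thesis
    by (simp add: drift_form_def algebra_simps)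
qed

lemma gen_A_eq:
  assumes "n \<ge> 1" "\<And>i. i \<in> coords n \<Longrightarrow> has_partial i f (f' i)"
  shows "gen_A \<tau> n f \<omega> = drift_form \<tau> n \<omega> (\<lambda>i. f' i \<omega>)"
proof -
  have "d_r x f = f' (Inl x)" if "x \<in> {1..n}" for x
    using assms(2)[OF InlI[OF that]] by (rule d_r_eq)
  moreover have "d_p x f = f' (Inr x)" if "x \<in> {0..n}" for x
    using assms(2)[OF InrI[OF that]] by (rule d_p_eq)
  ultimately show ?thesis
    using assms(1) by (cases \<omega>) (simp add: gen_A_def drift_form_def)
qed

text \<open>The generator on an untruncated coordinate, without the factor \<open>n^2\<close>. The
  boundary acts as if \<open>r_0 = 0\<close> and \<open>r_(n+1)\<close> were the tension. A bulk
  momentum is damped by two rotations at rate \<open>\<gamma> / 2\<close> each, an end momentum by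
  one rotation and by a bath at rate \<open>\<gamma>' / 2\<close>.\<close>

fun coord_drift :: "real \<Rightarrow> real \<Rightarrow> real \<Rightarrow> nat \<Rightarrow> nat + nat \<Rightarrow> config \<Rightarrow> real" where
  "coord_drift \<gamma> \<gamma>' \<tau> n (Inl x) \<omega> = snd \<omega> x - snd \<omega> (x - 1)"
| "coord_drift \<gamma> \<gamma>' \<tau> n (Inr x) \<omega> =
     (if x = n then \<tau> else fst \<omega> (x + 1)) - (if x = 0 then 0 else fst \<omega> x)
     - (if x = 0 \<or> x = n then (\<gamma> + \<gamma>') / 2 else \<gamma>) * snd \<omega> x"

text \<open>All terms in which a derivative falls on the cutoff, with one factor \<open>e\<close>
  taken out. The first comes from \<open>A\<close>, the others from the two baths. The
  \<open>e\<close> left inside balances the squared momentum beside it.\<close>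

definition remainder :: "real \<Rightarrow> real \<Rightarrow> real \<Rightarrow> real \<Rightarrow> nat \<Rightarrow> real \<Rightarrow> nat + nat \<Rightarrow> config \<Rightarrow> real" where
  "remainder \<gamma>' Tm Tp \<tau> n e j \<omega> =
     - 6 * \<tau> * (coord j \<omega> * snd \<omega> n) * (cutoff n e \<omega>)\<^sup>2
     + \<gamma>' / 2 * (Tm * (- 12 * of_bool (Inr 0 = j) * snd \<omega> 0 * (cutoff n e \<omega>)\<^sup>2
         - 6 * coord j \<omega> * (cutoff n e \<omega>)\<^sup>2 + 24 * e * (snd \<omega> 0)\<^sup>2 * coord j \<omega> * cutoff n e \<omega>)
       + 6 * (snd \<omega> 0)\<^sup>2 * coord j \<omega> * (cutoff n e \<omega>)\<^sup>2
       + Tp * (- 12 * of_bool (Inr n = j) * snd \<omega> n * (cutoff n e \<omega>)\<^sup>2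
         - 6 * coord j \<omega> * (cutoff n e \<omega>)\<^sup>2 + 24 * e * (snd \<omega> n)\<^sup>2 * coord j \<omega> * cutoff n e \<omega>)
       + 6 * (snd \<omega> n)\<^sup>2 * coord j \<omega> * (cutoff n e \<omega>)\<^sup>2)"

lemma rot_eq:
  assumes "has_partial (Inr x) f f1" "has_partial (Inr (Suc x)) f f2"
  shows "rot x f = (\<lambda>\<omega>. snd \<omega> (Suc x) * f1 \<omega> - snd \<omega> x * f2 \<omega>)"
  using assms[THEN d_p_eq] by (auto simp: rot_def)

lemma gen_bath_eq:
  assumes "has_partial (Inr 0) f f1" "has_partial (Inr 0) f1 f2"
    and "has_partial (Inr n) f g1" "has_partial (Inr n) g1 g2"
  shows "gen_bath Tm Tp n f \<omega> = Tm * f2 \<omega> - snd \<omega> 0 * f1 \<omega> + Tp * g2 \<omega> - snd \<omega> n * g1 \<omega>"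
  using assms[THEN d_p_eq] by (cases \<omega>) (simp add: gen_bath_def)

text \<open>The rotations preserve \<open>sqnorm\<close>, so they do not see the cutoff.\<close>

lemma rot_rot_trunc_coord:
  assumes "x < n"
  shows "rot x (rot x (trunc_coord n e j)) \<omega> =
    - (cutoff n e \<omega> ^ 3) * (of_bool (Inr x = j) * snd \<omega> x + of_bool (Inr (Suc x) = j) * snd \<omega> (Suc x))"
proof -
  let ?a = "of_bool (Inr x = j) :: real" and ?b = "- of_bool (Inr (Suc x) = j) :: real"
  have x: "Inr x \<in> coords n" "Inr (Suc x) \<in> coords n"
    using assms by auto
  have "rot x (trunc_coord n e j) =
      (\<lambda>\<omega>. (?a * coord (Inr (Suc x)) \<omega> + ?b * coord (Inr x) \<omega>) * cutoff n e \<omega> ^ 3)"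
    by (subst rot_eq[OF x[THEN has_partial_trunc_coord]]) (simp add: fun_eq_iff algebra_simps)
  then show ?thesis
    by (simp only: rot_eq[OF x[THEN has_partial_linear_cutoff]]) (simp add: algebra_simps)
qed

text \<open>Product rule: differentiating the coordinate gives its drift times the cutoff cubed. The
  cutoff's own derivatives enter through \<open>A\<close>, where \<open>drift_form_coord\<close>
  collapses them, and through the baths; the rotations contribute none.\<close>

lemma generator_trunc_coord:
  assumes "n \<ge> 1" "j \<in> coords n"
  shows "generator \<gamma> \<gamma>' Tm Tp \<tau> n (trunc_coord n e j) \<omega> =
    (real n)\<^sup>2 * (cutoff n e \<omega> ^ 3 * coord_drift \<gamma> \<gamma>' \<tau> n j \<omega> + e * remainder \<gamma>' Tm Tp \<tau> n e j \<omega>)"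
proof -
  let ?M = "cutoff n e \<omega>"
  have A: "gen_A \<tau> n (trunc_coord n e j) \<omega> =
      ?M ^ 3 * drift_form \<tau> n \<omega> (\<lambda>i. of_bool (i = j)) - 6 * e * coord j \<omega> * ?M\<^sup>2 * (\<tau> * snd \<omega> n)"
    using gen_A_eq[OF assms(1) has_partial_trunc_coord] assms(1)
    by (simp only: drift_form_linear drift_form_coord)
  have S: "gen_S n (trunc_coord n e j) \<omega> = - (?M ^ 3) *
      (\<Sum>x = 0..<n. of_bool (Inr x = j) * snd \<omega> x + of_bool (Inr (Suc x) = j) * snd \<omega> (Suc x))"
    unfolding gen_S_def sum_distrib_left by (intro sum.cong refl rot_rot_trunc_coord) auto
  have 0: "Inr 0 \<in> coords n" and n: "Inr n \<in> coords n"
    by auto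
  \<comment> \<open>\<open>remainder\<close> also contains the cutoff term of \<open>A\<close>,
    which is therefore added back in the bath identity.\<close>
  have B: "\<gamma>' / 2 * gen_bath Tm Tp n (trunc_coord n e j) \<omega> =
      e * remainder \<gamma>' Tm Tp \<tau> n e j \<omega> + 6 * e * coord j \<omega> * ?M\<^sup>2 * (\<tau> * snd \<omega> n)
      - \<gamma>' / 2 * (?M ^ 3 * (of_bool (Inr 0 = j) * snd \<omega> 0 + of_bool (Inr n = j) * snd \<omega> n))"
    unfolding remainder_def gen_bath_eq[OF has_partial_trunc_coord[OF 0] has_partial2_trunc_coord[OF 0]
        has_partial_trunc_coord[OF n] has_partial2_trunc_coord[OF n]] coord.simps
    by (simp only: divide_inverse) algebra
  \<comment> \<open>The indicator of \<open>j\<close> is the gradient of \<open>coord j\<close>. In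
    the rotation sum an interior momentum is selected twice and an end momentum once, which gives
    the two damping rates.\<close>
  have drift: "coord_drift \<gamma> \<gamma>' \<tau> n j \<omega> = drift_form \<tau> n \<omega> (\<lambda>i. of_bool (i = j))
      - \<gamma> / 2 * (\<Sum>x = 0..<n. of_bool (Inr x = j) * snd \<omega> x + of_bool (Inr (Suc x) = j) * snd \<omega> (Suc x))
      - \<gamma>' / 2 * (of_bool (Inr 0 = j) * snd \<omega> 0 + of_bool (Inr n = j) * snd \<omega> n)"
  proof -
    have of_bool: "of_bool Q * y = (if Q then y else 0)" "y * of_bool Q = (if Q then y else 0)"
      for Q and y :: real by simp_all
    show ?thesis
    proof (cases j)
      case (Inl x)
      then show ?thesis
        using assms by (auto simp: drift_form_def of_bool)
    next
      case (Inr x)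
      then have "x \<le> n" using assms by auto
      then show ?thesis
        using Inr assms
        by (cases x) (auto simp: drift_form_def of_bool sum.distrib field_simps)
    qed
  qed
  show ?thesis
    unfolding generator_def A S drift B by (simp add: algebra_simps)
qed

section \<open>Removing the cutoff\<close>

lemma borel_measurable_fst [measurable]:
  "x \<in> {1..n} \<Longrightarrow> (\<lambda>\<omega>. fst \<omega> x) \<in> borel_measurable (config_borel n)"
  unfolding config_borel_def
  by (rule measurable_compose[OF measurable_fst measurable_component_singleton])

lemma borel_measurable_snd [measurable]:
  "x \<in> {0..n} \<Longrightarrow> (\<lambda>\<omega>. snd \<omega> x) \<in> borel_measurable (config_borel n)"
  unfolding config_borel_def
  by (rule measurable_compose[OF measurable_snd measurable_component_singleton])

lemma borel_measurable_coord [measurable]: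
  "i \<in> coords n \<Longrightarrow> coord i \<in> borel_measurable (config_borel n)"
  using borel_measurable_fst borel_measurable_snd
  by (auto simp: coord.simps[abs_def])

lemma borel_measurable_cutoff [measurable]: "cutoff n e \<in> borel_measurable (config_borel n)"
  unfolding cutoff_def[abs_def] sqnorm_def
  by (intro borel_measurable_max borel_measurable_const borel_measurable_diff
      borel_measurable_times borel_measurable_sum borel_measurable_power borel_measurable_coord)

lemma borel_measurable_coord_drift [measurable]:
  assumes "j \<in> coords n"
  shows "coord_drift \<gamma> \<gamma>' \<tau> n j \<in> borel_measurable (config_borel n)"
proof (cases j)
  case (Inl x)
  then have "x \<in> {1..n}" using assms by auto
  then have "(\<lambda>\<omega>. snd \<omega> x - snd \<omega> (x - 1)) \<in> borel_measurable (config_borel n)"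
    by (intro borel_measurable_diff borel_measurable_snd) auto
  then show ?thesis using Inl by (simp add: coord_drift.simps[abs_def])
next
  case (Inr x)
  then have x: "x \<in> {0..n}" using assms by auto
  have "(\<lambda>\<omega>. if x = n then \<tau> else fst \<omega> (x + 1)) \<in> borel_measurable (config_borel n)"
    using x by (cases "x = n") (auto intro!: borel_measurable_fst)
  moreover have "(\<lambda>\<omega>. if x = 0 then 0 else fst \<omega> x) \<in> borel_measurable (config_borel n)"
    using x by (cases "x = 0") (auto intro!: borel_measurable_fst)
  ultimately have "(\<lambda>\<omega>. (if x = n then \<tau> else fst \<omega> (x + 1)) - (if x = 0 then 0 else fst \<omega> x)
     - (if x = 0 \<or> x = n then (\<gamma> + \<gamma>') / 2 else \<gamma>) * snd \<omega> x) \<in> borel_measurable (config_borel n)"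
    using x by (intro borel_measurable_diff borel_measurable_times borel_measurable_const borel_measurable_snd)
  then show ?thesis using Inr by (simp add: coord_drift.simps[abs_def])
qed

lemma borel_measurable_remainder [measurable]:
  assumes "j \<in> coords n"
  shows "remainder \<gamma>' Tm Tp \<tau> n e j \<in> borel_measurable (config_borel n)"
proof -
  note [measurable] = assms
  have [measurable]: "(\<lambda>\<omega>. snd \<omega> 0) \<in> borel_measurable (config_borel n)"
      "(\<lambda>\<omega>. snd \<omega> n) \<in> borel_measurable (config_borel n)"
    by (auto intro!: borel_measurable_snd)
  show ?thesis
    unfolding remainder_def[abs_def] by measurable
qed

lemma continuous_on_fst_snd:
  fixes S :: "config set"
  shows "continuous_on S (\<lambda>\<omega>. fst \<omega> x)" "continuous_on S (\<lambda>\<omega>. snd \<omega> x)"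
  using continuous_on_coord[of S "Inl x"] continuous_on_coord[of S "Inr x"]
  by (simp_all add: coord.simps[abs_def])

lemma continuous_on_coord_drift: "continuous_on S (coord_drift \<gamma> \<gamma>' \<tau> n j)"
proof (cases j)
  case (Inl x)
  have "continuous_on S (\<lambda>\<omega>. snd \<omega> x - snd \<omega> (x - 1))"
    by (intro continuous_on_diff continuous_on_fst_snd)
  then show ?thesis using Inl by (simp add: coord_drift.simps[abs_def])
next
  case (Inr x)
  have "continuous_on S (\<lambda>\<omega>. if x = n then \<tau> else fst \<omega> (x + 1))"
    "continuous_on S (\<lambda>\<omega>. if x = 0 then 0 else fst \<omega> x)"
    by (cases "x = n"; cases "x = 0"; simp add: continuous_on_fst_snd)+
  then have "continuous_on S (\<lambda>\<omega>. (if x = n then \<tau> else fst \<omega> (x + 1)) - (if x = 0 then 0 else fst \<omega> x)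
     - (if x = 0 \<or> x = n then (\<gamma> + \<gamma>') / 2 else \<gamma>) * snd \<omega> x)"
    by (intro continuous_on_diff continuous_on_mult continuous_on_const continuous_on_fst_snd)
  then show ?thesis using Inr by (simp add: coord_drift.simps[abs_def])
qed

lemma continuous_on_remainder: "continuous_on S (remainder \<gamma>' Tm Tp \<tau> n e j)"
  unfolding remainder_def[abs_def]
  by (intro continuous_on_add continuous_on_diff continuous_on_mult continuous_on_const continuous_on_power
      continuous_on_fst_snd continuous_on_cutoff continuous_on_coord)

lemma bounded_image_if_zero_outside_cube:
  assumes "continuous_on UNIV f" "\<And>\<omega>. \<omega> \<in> Omega n - cube n b \<Longrightarrow> f \<omega> = (0::real)"
  shows "bounded (f ` Omega n)"
proof -
  have "compact (f ` cube n b)"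
    by (intro compact_continuous_image continuous_on_subset[OF assms(1)] cube) auto
  then have "bounded (insert 0 (f ` cube n b))"
    by (simp add: compact_imp_bounded)
  then show ?thesis
    by (rule bounded_subset) (use assms(2) in blast)
qed

lemma stationary_measure_integral_trunc_coord:
  assumes "n \<ge> 1" "stationary_measure n (generator \<gamma> \<gamma>' Tm Tp \<tau> n) \<mu>" "j \<in> coords n" "0 < e" "e \<le> 1"
  shows "(\<integral>\<omega>. cutoff n e \<omega> ^ 3 * coord_drift \<gamma> \<gamma>' \<tau> n j \<omega> + e * remainder \<gamma>' Tm Tp \<tau> n e j \<omega> \<partial>\<mu>) = 0"
proof -
  let ?g = "\<lambda>\<omega>. (real n)\<^sup>2 *
    (cutoff n e \<omega> ^ 3 * coord_drift \<gamma> \<gamma>' \<tau> n j \<omega> + e * remainder \<gamma>' Tm Tp \<tau> n e j \<omega>)"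
  have L: "generator \<gamma> \<gamma>' Tm Tp \<tau> n (trunc_coord n e j) = ?g"
    using generator_trunc_coord[OF assms(1,3)] by auto
  have g: "continuous_on UNIV ?g"
    by (intro continuous_on_add continuous_on_mult continuous_on_const continuous_on_power
        continuous_on_cutoff continuous_on_coord_drift continuous_on_remainder)
  have f: "continuous_on UNIV (trunc_coord n e j)"
    using smooth_trunc_coord by (rule smooth_continuous)
  note [measurable] = assms(3)
  have "(\<integral>\<omega>. generator \<gamma> \<gamma>' Tm Tp \<tau> n (trunc_coord n e j) \<omega> \<partial>\<mu>) = 0"
  proof (rule stationary_measure_integral_generator[OF assms(2)])
    show "test_function n (trunc_coord n e j)"
      using assms(4,5) by (rule test_function_trunc_coord)
    show "continuous_on (Omega n) (generator \<gamma> \<gamma>' Tm Tp \<tau> n (trunc_coord n e j))"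
      unfolding L by (rule continuous_on_subset[OF g]) simp
    show "bounded (generator \<gamma> \<gamma>' Tm Tp \<tau> n (trunc_coord n e j) ` Omega n)"
      unfolding L
      by (rule bounded_image_if_zero_outside_cube[OF g, of n "1 / e"])
        (simp add: cutoff_eq_0_outside_cube assms remainder_def)
    show "bounded (trunc_coord n e j ` Omega n)"
      by (rule bounded_image_if_zero_outside_cube[OF f, of n "1 / e"])
        (simp add: cutoff_eq_0_outside_cube assms trunc_coord_def)
    show "generator \<gamma> \<gamma>' Tm Tp \<tau> n (trunc_coord n e j) \<in> borel_measurable (config_borel n)"
      unfolding L by measurable
    show "trunc_coord n e j \<in> borel_measurable (config_borel n)"
      unfolding trunc_coord_def[abs_def] by measurable
  qed
  then show ?thesis
    using assms(1) by (simp add: L)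
qed

lemma integrable_coord:
  assumes "prob_space \<mu>" "sets \<mu> = sets (config_borel n)" "finite_second_moments n \<mu>" "i \<in> coords n"
  shows "integrable \<mu> (\<lambda>\<omega>. (coord i \<omega>)\<^sup>2)" "integrable \<mu> (coord i)"
proof -
  interpret prob_space \<mu> by fact
  show sq: "integrable \<mu> (\<lambda>\<omega>. (coord i \<omega>)\<^sup>2)"
    using assms(3,4) by (auto simp: finite_second_moments_def case_prod_unfold)
  have "coord i \<in> borel_measurable \<mu>"
    using borel_measurable_coord[OF assms(4)] measurable_cong_sets[OF assms(2) refl] by blast
  then show "integrable \<mu> (coord i)"
    using sq by (rule square_integrable_imp_integrable)
qed

text \<open>Where the cutoff is nonzero, \<open>e * sqnorm n \<omega>\<close> is below 1. This
  absorbs the squared momenta in the remainder uniformly in \<open>e\<close>.\<close>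

lemma mult_cutoff_le_1:
  assumes "i \<in> coords n" "0 \<le> e"
  shows "e * (coord i \<omega>)\<^sup>2 * cutoff n e \<omega> \<le> 1"
proof (cases "cutoff n e \<omega> = 0")
  case False
  then have "e * sqnorm n \<omega> \<le> 1" by (auto simp: cutoff_def max_def split: if_splits)
  moreover have "e * (coord i \<omega>)\<^sup>2 \<le> e * sqnorm n \<omega>"
    using assms by (intro mult_left_mono coord_sq_le_sqnorm)
  ultimately show ?thesis
    by (intro mult_le_one[of "e * _"] cutoff_nonneg cutoff_le_1 assms(2)) linarith
qed simp

lemma abs_mult_unit_le: "0 \<le> y \<Longrightarrow> y \<le> 1 \<Longrightarrow> \<bar>x * y\<bar> \<le> \<bar>x\<bar>" for x y :: real
  by (simp add: abs_mult mult_left_le)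

text \<open>Each cubic term carries a factor \<open>e p^2 M\<close> with \<open>M\<close> the
  cutoff, which is at most 1, so it grows only linearly. The term from \<open>A\<close> stays
  quadratic. The bound is free of \<open>e\<close> and is integrable under second moments.\<close>

lemma abs_remainder_le:
  assumes "0 \<le> e" "e \<le> 1" "0 \<le> \<gamma>'" "0 \<le> Tm" "0 \<le> Tp"
  shows "\<bar>e * remainder \<gamma>' Tm Tp \<tau> n e j \<omega>\<bar> \<le> 6 * \<bar>\<tau>\<bar> * \<bar>coord j \<omega> * snd \<omega> n\<bar>
    + \<gamma>' / 2 * (Tm * (12 * \<bar>snd \<omega> 0\<bar> + 30 * \<bar>coord j \<omega>\<bar>) + 6 * \<bar>coord j \<omega>\<bar>
      + Tp * (12 * \<bar>snd \<omega> n\<bar> + 30 * \<bar>coord j \<omega>\<bar>) + 6 * \<bar>coord j \<omega>\<bar>)"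
proof -
  define M c where "M = cutoff n e \<omega>" and "c = coord j \<omega>"
  have M: "0 \<le> M" "M \<le> 1"
    using assms cutoff_nonneg cutoff_le_1 by (auto simp: M_def)
  have m: "0 \<le> e * M\<^sup>2" "e * M\<^sup>2 \<le> 1"
    using M assms by (auto intro!: mult_le_one power_le_one)
  have s: "0 \<le> e * (snd \<omega> x)\<^sup>2 * M" "e * (snd \<omega> x)\<^sup>2 * M \<le> 1" if "x \<le> n" for x
  proof -
    have "Inr x \<in> coords n" using that by auto
    from mult_cutoff_le_1[OF this assms(1), of \<omega>] show "e * (snd \<omega> x)\<^sup>2 * M \<le> 1"
      by (simp add: M_def)
    show "0 \<le> e * (snd \<omega> x)\<^sup>2 * M" using M(1) assms(1) by simp
  qed
  have sM: "0 \<le> e * (snd \<omega> x)\<^sup>2 * M * M" "e * (snd \<omega> x)\<^sup>2 * M * M \<le> 1" if "x \<le> n" for x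
    using s[OF that] M by (auto intro: mult_le_one[of "e * (snd \<omega> x)\<^sup>2 * M"])
  \<comment> \<open>Here \<open>s\<close> stands for \<open>e p^2 M\<close> at an end of the chain,
    and 30 is 6 + 24.\<close>
  have bath: "\<bar>- 12 * of_bool Q * q * (e * M\<^sup>2) - 6 * c * (e * M\<^sup>2) + 24 * c * (s * e)\<bar>
      \<le> 12 * \<bar>q\<bar> + 30 * \<bar>c\<bar>" if "0 \<le> s" "s \<le> 1" for Q q s
  proof -
    have "\<bar>(- 12 * of_bool Q * q) * (e * M\<^sup>2)\<bar> \<le> \<bar>- 12 * of_bool Q * q\<bar>"
      using m by (rule abs_mult_unit_le)
    moreover have "\<bar>- 12 * of_bool Q * q\<bar> \<le> 12 * \<bar>q\<bar>"
      by (auto simp: abs_mult)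
    moreover have "\<bar>(6 * c) * (e * M\<^sup>2)\<bar> \<le> \<bar>6 * c\<bar>"
      using m by (rule abs_mult_unit_le)
    moreover have "\<bar>(24 * c) * (s * e)\<bar> \<le> \<bar>24 * c\<bar>"
      using that assms by (intro abs_mult_unit_le mult_le_one) auto
    ultimately show ?thesis by linarith
  qed
  have tot: "\<bar>e * remainder \<gamma>' Tm Tp \<tau> n e j \<omega>\<bar> \<le> \<bar>a\<bar> + \<gamma>' / 2 * (Tm * \<bar>b\<bar> + \<bar>b'\<bar> + Tp * \<bar>d\<bar> + \<bar>d'\<bar>)"
    if "e * remainder \<gamma>' Tm Tp \<tau> n e j \<omega> = a + \<gamma>' / 2 * (Tm * b + b' + Tp * d + d')" for a b b' d d'
  proof -
    have "\<bar>Tm * b + b' + Tp * d + d'\<bar> \<le> \<bar>Tm * b\<bar> + \<bar>b'\<bar> + \<bar>Tp * d\<bar> + \<bar>d'\<bar>" by linarith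
    then have "\<gamma>' / 2 * \<bar>Tm * b + b' + Tp * d + d'\<bar> \<le> \<gamma>' / 2 * (Tm * \<bar>b\<bar> + \<bar>b'\<bar> + Tp * \<bar>d\<bar> + \<bar>d'\<bar>)"
      using assms by (intro mult_left_mono) (auto simp: abs_mult)
    moreover have "\<bar>\<gamma>' / 2 * (Tm * b + b' + Tp * d + d')\<bar> = \<gamma>' / 2 * \<bar>Tm * b + b' + Tp * d + d'\<bar>"
      using assms by (simp add: abs_mult)
    ultimately show ?thesis unfolding that by linarith
  qed
  have "\<bar>e * remainder \<gamma>' Tm Tp \<tau> n e j \<omega>\<bar> \<le> \<bar>(- 6 * \<tau> * (c * snd \<omega> n)) * (e * M\<^sup>2)\<bar> + \<gamma>' / 2 *
     (Tm * \<bar>- 12 * of_bool (Inr 0 = j) * snd \<omega> 0 * (e * M\<^sup>2) - 6 * c * (e * M\<^sup>2) + 24 * c * (e * (snd \<omega> 0)\<^sup>2 * M * e)\<bar>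
      + \<bar>(6 * c) * (e * (snd \<omega> 0)\<^sup>2 * M * M)\<bar>
      + Tp * \<bar>- 12 * of_bool (Inr n = j) * snd \<omega> n * (e * M\<^sup>2) - 6 * c * (e * M\<^sup>2) + 24 * c * (e * (snd \<omega> n)\<^sup>2 * M * e)\<bar>
      + \<bar>(6 * c) * (e * (snd \<omega> n)\<^sup>2 * M * M)\<bar>)"
    by (rule tot) (simp add: remainder_def M_def[symmetric] c_def[symmetric] algebra_simps power2_eq_square)
  also have "\<dots> \<le> \<bar>- 6 * \<tau> * (c * snd \<omega> n)\<bar>
    + \<gamma>' / 2 * (Tm * (12 * \<bar>snd \<omega> 0\<bar> + 30 * \<bar>c\<bar>) + \<bar>6 * c\<bar>
      + Tp * (12 * \<bar>snd \<omega> n\<bar> + 30 * \<bar>c\<bar>) + \<bar>6 * c\<bar>)"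
    using assms
    by (intro add_mono mult_left_mono abs_mult_unit_le bath s sM m) auto
  finally show ?thesis
    by (simp add: abs_mult c_def)
qed

text \<open>As \<open>e\<close> tends to 0 the cutoff tends to 1 and \<open>e * remainder\<close> to
  0 pointwise; \<open>abs_remainder_le\<close> supplies the dominating function.\<close>

lemma stationary_measure_integral_coord_drift:
  assumes "n \<ge> 1" "stationary_measure n (generator \<gamma> \<gamma>' Tm Tp \<tau> n) \<mu>" "finite_second_moments n \<mu>"
    and "j \<in> coords n" "0 \<le> \<gamma>'" "0 \<le> Tm" "0 \<le> Tp"
  shows "(\<integral>\<omega>. coord_drift \<gamma> \<gamma>' \<tau> n j \<omega> \<partial>\<mu>) = 0"
proof -
  have prob: "prob_space \<mu>" and sets: "sets \<mu> = sets (config_borel n)"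
    using assms(2) by (auto simp: stationary_measure_def)
  interpret prob_space \<mu> by fact
  note [measurable_cong] = sets and [measurable] = assms(4)
  note int = integrable_coord(2)[OF prob sets assms(3)]
  have int_r: "integrable \<mu> (\<lambda>\<omega>. fst \<omega> x)" if "x \<in> {1..n}" for x
    using int[OF InlI[OF that]] by (simp add: coord.simps[abs_def])
  have int_p: "integrable \<mu> (\<lambda>\<omega>. snd \<omega> x)" if "x \<in> {0..n}" for x
    using int[OF InrI[OF that]] by (simp add: coord.simps[abs_def])
  have int_p2: "integrable \<mu> (\<lambda>\<omega>. (snd \<omega> n)\<^sup>2)"
    using integrable_coord(1)[OF prob sets assms(3) InrI[of n]] by simp
  have [measurable]: "(\<lambda>\<omega>. snd \<omega> n) \<in> borel_measurable (config_borel n)"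
    by (rule borel_measurable_snd) simp
  \<comment> \<open>The one quadratic term of the dominating function, controlled by the second
    moments.\<close>
  have int_prod: "integrable \<mu> (\<lambda>\<omega>. coord j \<omega> * snd \<omega> n)"
  proof (rule Bochner_Integration.integrable_bound)
    show "integrable \<mu> (\<lambda>\<omega>. (coord j \<omega>)\<^sup>2 + (snd \<omega> n)\<^sup>2)"
      by (intro Bochner_Integration.integrable_add int_p2 integrable_coord(1)[OF prob sets assms(3,4)])
    have "\<bar>a * b\<bar> \<le> \<bar>a\<^sup>2 + b\<^sup>2\<bar>" for a b :: real
    proof -
      have "2 * \<bar>a\<bar> * \<bar>b\<bar> \<le> a\<^sup>2 + b\<^sup>2" "0 \<le> \<bar>a\<bar> * \<bar>b\<bar>"
        using sum_squares_bound[of "\<bar>a\<bar>" "\<bar>b\<bar>"] by simp_all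
      then show ?thesis unfolding abs_mult by linarith
    qed
    then show "AE \<omega> in \<mu>. norm (coord j \<omega> * snd \<omega> n) \<le> norm ((coord j \<omega>)\<^sup>2 + (snd \<omega> n)\<^sup>2)"
      by simp
  qed measurable
  have int_drift: "integrable \<mu> (coord_drift \<gamma> \<gamma>' \<tau> n j)"
  proof (cases j)
    case (Inl x)
    then have "x \<in> {1..n}" using assms(4) by auto
    then have "integrable \<mu> (\<lambda>\<omega>. snd \<omega> x - snd \<omega> (x - 1))"
      by (intro Bochner_Integration.integrable_diff int_p) auto
    then show ?thesis using Inl by (simp add: coord_drift.simps[abs_def])
  next
    case (Inr x)
    then have x: "x \<in> {0..n}" using assms(4) by auto
    have "integrable \<mu> (\<lambda>\<omega>. if x = n then \<tau> else fst \<omega> (x + 1))"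
      using x by (cases "x = n") (auto intro!: int_r)
    moreover have "integrable \<mu> (\<lambda>\<omega>. if x = 0 then 0 else fst \<omega> x)"
      using x by (cases "x = 0") (auto intro!: int_r)
    ultimately have "integrable \<mu> (\<lambda>\<omega>. (if x = n then \<tau> else fst \<omega> (x + 1)) - (if x = 0 then 0 else fst \<omega> x)
       - (if x = 0 \<or> x = n then (\<gamma> + \<gamma>') / 2 else \<gamma>) * snd \<omega> x)"
      using x by (intro Bochner_Integration.integrable_diff integrable_mult_right int_p)
    then show ?thesis using Inr by (simp add: coord_drift.simps[abs_def])
  qed
  define e where "e k = inverse (real (Suc k))" for k
  have e: "0 < e k" "e k \<le> 1" for k
    by (simp_all add: e_def field_simps)
  have e0: "e \<longlonglongrightarrow> 0"
    using LIMSEQ_inverse_real_of_nat by (simp add: e_def[abs_def])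
  have "(\<lambda>k. \<integral>\<omega>. cutoff n (e k) \<omega> ^ 3 * coord_drift \<gamma> \<gamma>' \<tau> n j \<omega>
        + e k * remainder \<gamma>' Tm Tp \<tau> n (e k) j \<omega> \<partial>\<mu>)
      \<longlonglongrightarrow> (\<integral>\<omega>. coord_drift \<gamma> \<gamma>' \<tau> n j \<omega> \<partial>\<mu>)"
  proof (rule integral_dominated_convergence)
    show "integrable \<mu> (\<lambda>\<omega>. \<bar>coord_drift \<gamma> \<gamma>' \<tau> n j \<omega>\<bar> + (6 * \<bar>\<tau>\<bar> * \<bar>coord j \<omega> * snd \<omega> n\<bar>
      + \<gamma>' / 2 * (Tm * (12 * \<bar>snd \<omega> 0\<bar> + 30 * \<bar>coord j \<omega>\<bar>) + 6 * \<bar>coord j \<omega>\<bar>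
        + Tp * (12 * \<bar>snd \<omega> n\<bar> + 30 * \<bar>coord j \<omega>\<bar>) + 6 * \<bar>coord j \<omega>\<bar>)))"
      by (intro Bochner_Integration.integrable_add integrable_mult_right integrable_abs
          int_drift int_prod int_p int[OF assms(4)]) auto
    show "AE \<omega> in \<mu>. norm (cutoff n (e k) \<omega> ^ 3 * coord_drift \<gamma> \<gamma>' \<tau> n j \<omega>
        + e k * remainder \<gamma>' Tm Tp \<tau> n (e k) j \<omega>)
      \<le> \<bar>coord_drift \<gamma> \<gamma>' \<tau> n j \<omega>\<bar> + (6 * \<bar>\<tau>\<bar> * \<bar>coord j \<omega> * snd \<omega> n\<bar>
      + \<gamma>' / 2 * (Tm * (12 * \<bar>snd \<omega> 0\<bar> + 30 * \<bar>coord j \<omega>\<bar>) + 6 * \<bar>coord j \<omega>\<bar>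
        + Tp * (12 * \<bar>snd \<omega> n\<bar> + 30 * \<bar>coord j \<omega>\<bar>) + 6 * \<bar>coord j \<omega>\<bar>))" for k
    proof (rule AE_I2)
      fix \<omega>
      have "\<bar>coord_drift \<gamma> \<gamma>' \<tau> n j \<omega> * cutoff n (e k) \<omega> ^ 3\<bar> \<le> \<bar>coord_drift \<gamma> \<gamma>' \<tau> n j \<omega>\<bar>"
        using e[of k] cutoff_nonneg cutoff_le_1
        by (intro abs_mult_unit_le power_le_one zero_le_power) auto
      then show "norm (cutoff n (e k) \<omega> ^ 3 * coord_drift \<gamma> \<gamma>' \<tau> n j \<omega>
          + e k * remainder \<gamma>' Tm Tp \<tau> n (e k) j \<omega>)
        \<le> \<bar>coord_drift \<gamma> \<gamma>' \<tau> n j \<omega>\<bar> + (6 * \<bar>\<tau>\<bar> * \<bar>coord j \<omega> * snd \<omega> n\<bar>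
        + \<gamma>' / 2 * (Tm * (12 * \<bar>snd \<omega> 0\<bar> + 30 * \<bar>coord j \<omega>\<bar>) + 6 * \<bar>coord j \<omega>\<bar>
          + Tp * (12 * \<bar>snd \<omega> n\<bar> + 30 * \<bar>coord j \<omega>\<bar>) + 6 * \<bar>coord j \<omega>\<bar>))"
        using abs_remainder_le[OF less_imp_le[OF e(1)] e(2) assms(5-7), where \<tau>=\<tau> and n=n and j=j and \<omega>=\<omega>]
        unfolding real_norm_def
        by (intro order_trans[OF abs_triangle_ineq] add_mono) (simp_all add: mult.commute)
    qed
    show "AE \<omega> in \<mu>. (\<lambda>k. cutoff n (e k) \<omega> ^ 3 * coord_drift \<gamma> \<gamma>' \<tau> n j \<omega>
        + e k * remainder \<gamma>' Tm Tp \<tau> n (e k) j \<omega>) \<longlonglongrightarrow> coord_drift \<gamma> \<gamma>' \<tau> n j \<omega>"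
    proof (rule AE_I2)
      fix \<omega>
      have "(\<lambda>k. cutoff n (e k) \<omega>) \<longlonglongrightarrow> max 0 (1 - 0 * sqnorm n \<omega>)"
        unfolding cutoff_def by (intro tendsto_intros e0)
      then have c: "(\<lambda>k. cutoff n (e k) \<omega>) \<longlonglongrightarrow> 1"
        by simp
      \<comment> \<open>Convergence to some \<open>l\<close> is enough, because the factor
        \<open>e k\<close> tends to 0.\<close>
      have "\<exists>l. (\<lambda>k. remainder \<gamma>' Tm Tp \<tau> n (e k) j \<omega>) \<longlonglongrightarrow> l"
        unfolding remainder_def
        by (rule exI) (rule tendsto_add tendsto_diff tendsto_mult tendsto_power c e0 tendsto_const)+
      then obtain l where "(\<lambda>k. remainder \<gamma>' Tm Tp \<tau> n (e k) j \<omega>) \<longlonglongrightarrow> l" ..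
      then have "(\<lambda>k. cutoff n (e k) \<omega> ^ 3 * coord_drift \<gamma> \<gamma>' \<tau> n j \<omega>
          + e k * remainder \<gamma>' Tm Tp \<tau> n (e k) j \<omega>) \<longlonglongrightarrow> 1 ^ 3 * coord_drift \<gamma> \<gamma>' \<tau> n j \<omega> + 0 * l"
        by (intro tendsto_intros c e0)
      then show "(\<lambda>k. cutoff n (e k) \<omega> ^ 3 * coord_drift \<gamma> \<gamma>' \<tau> n j \<omega>
          + e k * remainder \<gamma>' Tm Tp \<tau> n (e k) j \<omega>) \<longlonglongrightarrow> coord_drift \<gamma> \<gamma>' \<tau> n j \<omega>"
        by simp
    qed
  qed measurable
  then show ?thesis
    using stationary_measure_integral_trunc_coord[OF assms(1,2,4) e] by (simp add: LIMSEQ_const_iff)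
qed

section \<open>The stationary profile\<close>

text \<open>Momenta and the left boundary condition express everything through \<open>p 0\<close>;
  the right boundary condition then determines \<open>p 0\<close>.\<close>

lemma affine_recurrence_solution:
  fixes R p :: "nat \<Rightarrow> real" and \<gamma> \<gamma>' \<tau> :: real
  assumes "n \<ge> 1" "\<gamma> > 0" "\<gamma>' > 0"
    and p: "\<And>x. x \<in> {1..n} \<Longrightarrow> p x = p (x - 1)"
    and R1: "R 1 = (\<gamma> + \<gamma>') / 2 * p 0"
    and R: "\<And>x. x \<in> {1..<n} \<Longrightarrow> R (x + 1) = R x + \<gamma> * p x"
    and Rn: "\<tau> = R n + (\<gamma> + \<gamma>') / 2 * p n"
    and "x \<in> {1..n}"
  shows "R x = \<tau> * (\<gamma> * real x + (\<gamma>' - \<gamma>) / 2) / (real n * \<gamma> + \<gamma>')"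
proof -
  have p0: "p x = p 0" if "x \<le> n" for x
    using that by (induction x) (use p in force)+
  have R0: "R x = (\<gamma> * real x + (\<gamma>' - \<gamma>) / 2) * p 0" if "1 \<le> x" "x \<le> n" for x
    using that
  proof (induction x rule: nat_induct_at_least)
    case base
    then show ?case using R1 by (simp add: field_simps)
  next
    case (Suc x)
    then show ?case using R[of x] p0[of x] by (simp add: field_simps)
  qed
  \<comment> \<open>The half-sums at the two ends add up: \<open>(\<gamma>' - \<gamma>) / 2 +
    (\<gamma> + \<gamma>') / 2 = \<gamma>'\<close>.\<close>
  have "\<tau> = (real n * \<gamma> + \<gamma>') * p 0"
    using Rn R0[of n] p0[of n] assms(1) by (simp add: field_simps)
  moreover have "real n * \<gamma> + \<gamma>' > 0"
    using assms(2,3) by (simp add: add_nonneg_pos)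
  moreover have "R x = (\<gamma> * real x + (\<gamma>' - \<gamma>) / 2) * p 0"
    using R0 assms(8) by simp
  ultimately show ?thesis
    by (simp add: nonzero_eq_divide_eq mult_ac)
qed

text \<open>The real \<open>y\<close> stands for a site within distance 1 of \<open>N * u\<close>,
  which covers both the integer part of \<open>n u\<close> and the exact grid point
  \<open>u = x / n\<close>.\<close>

lemma affine_profile_error:
  fixes \<gamma> \<gamma>' \<tau> u y N :: real
  assumes "\<gamma> > 0" "\<gamma>' > 0" "N > 0" "0 \<le> u" "u \<le> 1" "\<bar>y - N * u\<bar> \<le> 1"
  shows "\<bar>\<tau> * (\<gamma> * y + (\<gamma>' - \<gamma>) / 2) / (N * \<gamma> + \<gamma>') - \<tau> * u\<bar>
    \<le> \<bar>\<tau>\<bar> * (\<gamma> + \<bar>\<gamma>' - \<gamma>\<bar> / 2 + \<gamma>') / \<gamma> / N"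
proof -
  have pos: "N * \<gamma> + \<gamma>' > 0" using assms by (simp add: add_pos_pos)
  \<comment> \<open>Over the common denominator the terms of order \<open>N\<close> combine into
    \<open>\<gamma> * (y - N * u)\<close>, so the numerator stays bounded.\<close>
  have "\<tau> * (\<gamma> * y + (\<gamma>' - \<gamma>) / 2) / (N * \<gamma> + \<gamma>') - \<tau> * u
      = \<tau> * (\<gamma> * (y - N * u) + (\<gamma>' - \<gamma>) / 2 - \<gamma>' * u) / (N * \<gamma> + \<gamma>')"
    using pos by (simp add: field_simps)
  then have eq: "\<bar>\<tau> * (\<gamma> * y + (\<gamma>' - \<gamma>) / 2) / (N * \<gamma> + \<gamma>') - \<tau> * u\<bar>
      = \<bar>\<tau>\<bar> * \<bar>\<gamma> * (y - N * u) + (\<gamma>' - \<gamma>) / 2 - \<gamma>' * u\<bar> / (N * \<gamma> + \<gamma>')"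
    using pos by (simp add: abs_mult)
  have "\<bar>\<gamma> * (y - N * u)\<bar> \<le> \<gamma> * 1" "\<bar>\<gamma>' * u\<bar> \<le> \<gamma>' * 1"
    using assms by (auto simp: abs_mult simp del: mult_1_right intro!: mult_left_mono)
  moreover have "\<bar>a + c / 2 - b\<bar> \<le> A + \<bar>c\<bar> / 2 + B" if "\<bar>a\<bar> \<le> A * 1" "\<bar>b\<bar> \<le> B * 1" for a b c A B :: real
    using that by linarith
  ultimately have "\<bar>\<gamma> * (y - N * u) + (\<gamma>' - \<gamma>) / 2 - \<gamma>' * u\<bar> \<le> \<gamma> + \<bar>\<gamma>' - \<gamma>\<bar> / 2 + \<gamma>'"
    by blast
  then have "\<bar>\<tau>\<bar> * \<bar>\<gamma> * (y - N * u) + (\<gamma>' - \<gamma>) / 2 - \<gamma>' * u\<bar> / (N * \<gamma> + \<gamma>')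
      \<le> \<bar>\<tau>\<bar> * (\<gamma> + \<bar>\<gamma>' - \<gamma>\<bar> / 2 + \<gamma>') / (N * \<gamma>)"
    using assms by (intro frac_le mult_left_mono) auto
  then show ?thesis
    unfolding eq by (simp add: mult.commute)
qed

text \<open>Uniform continuity makes \<open>H\<close> vary by less than \<open>r / 2\<close> on each
  cell once the mesh \<open>1 / n\<close> is below \<open>d\<close>.\<close>

lemma riemann_sum_tendsto_integral:
  fixes H :: "real \<Rightarrow> real"
  assumes H: "continuous_on {0..1} H"
  shows "(\<lambda>n. 1 / real n * (\<Sum>x = 1..n. H (real x / real n))) \<longlonglongrightarrow> integral {0..1} H"
proof (rule LIMSEQ_I)
  fix r :: real
  assume "r > 0"
  then have "r / 2 > 0" by simp
  moreover have "uniformly_continuous_on {0..1} H"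
    using H by (intro compact_uniformly_continuous) auto
  ultimately obtain d where d: "d > 0"
    "\<And>s t. s \<in> {0..1} \<Longrightarrow> t \<in> {0..1} \<Longrightarrow> dist t s < d \<Longrightarrow> dist (H t) (H s) < r / 2"
    unfolding uniformly_continuous_on_def by metis
  obtain N :: nat where N: "1 / d < real N" using reals_Archimedean2 by blast
  have "norm (1 / real n * (\<Sum>x = 1..n. H (real x / real n)) - integral {0..1} H) < r" if "n \<ge> N" for n
  proof -
    have "0 < 1 / d" using d(1) by simp
    then have n: "1 / d < real n" "n > 0"
      using N that by (linarith, metis N gr0I leD le_zero_eq less_eq_real_def of_nat_0 that)
    have step: "1 / real n < d"
      using n d(1) by (simp add: field_simps)
    \<comment> \<open>The error is allowed to grow in proportion to the length covered, so adding
      one cell preserves the bound and \<open>m = n\<close> gives \<open>r / 2\<close>.\<close>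
    have "\<bar>integral {0..real m / real n} H - (\<Sum>x = 1..m. 1 / real n * H (real x / real n))\<bar>
        \<le> r / 2 * (real m / real n)" if "m \<le> n" for m
      using that
    proof (induction m)
      case 0
      then show ?case by simp
    next
      case (Suc m)
      let ?a = "real m / real n" and ?b = "real (Suc m) / real n"
      have ab: "0 \<le> ?a" "?a \<le> ?b" "?b \<le> 1" "?b - ?a = 1 / real n"
        using Suc.prems n by (auto simp: field_simps)
      have cont: "continuous_on {?a..?b} H"
        using ab by (intro continuous_on_subset[OF H]) auto
      have "integral {0..?a} H + integral {?a..?b} H = integral {0..?b} H"
        using ab by (intro Henstock_Kurzweil_Integration.integral_combine integrable_continuous_real
            continuous_on_subset[OF H]) auto
      moreover have "integral {?a..?b} (\<lambda>t. H t - H ?b) = integral {?a..?b} H - (?b - ?a) * H ?b"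
        using ab cont by (simp add: Henstock_Kurzweil_Integration.integral_diff integrable_continuous_real)
      moreover have "norm (integral {?a..?b} (\<lambda>t. H t - H ?b)) \<le> r / 2 * (?b - ?a)"
      proof (rule integral_bound)
        show "norm (H t - H ?b) \<le> r / 2" if "t \<in> {?a..?b}" for t
        proof -
          have "?a \<le> t" "t \<le> ?b" using that by simp_all
          then have "t \<in> {0..1}" "?b \<in> {0..1}" "dist t ?b < d"
            using ab step unfolding atLeastAtMost_iff dist_real_def by linarith+
          then show ?thesis using d(2)[of ?b t] by (simp add: dist_real_def)
        qed
      qed (use ab cont in \<open>auto intro!: continuous_intros\<close>)
      moreover have "(\<Sum>x = 1..Suc m. 1 / real n * H (real x / real n))
          = (\<Sum>x = 1..m. 1 / real n * H (real x / real n)) + (?b - ?a) * H ?b"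
        using ab(4) by simp
      moreover have "r / 2 * ?b = r / 2 * ?a + r / 2 * (?b - ?a)"
        by (simp add: algebra_simps)
      ultimately show ?case
        using Suc.IH Suc.prems unfolding real_norm_def by linarith
    qed
    from this[of n] n(2) \<open>r > 0\<close> show ?thesis
      by (simp add: sum_distrib_left abs_minus_commute)
  qed
  then show "\<exists>N. \<forall>n\<ge>N. norm (1 / real n * (\<Sum>x = 1..n. H (real x / real n)) - integral {0..1} H) < r"
    by blast
qed

text \<open>The vanishing mean drifts are the recurrence: \<open>Inl x\<close> makes the mean
  momenta constant, \<open>Inr 0\<close> and \<open>Inr n\<close> give the boundary conditions, and
  the interior \<open>Inr x\<close> give the increments of the mean stretch.\<close>

lemma stationary_mean_stretch:
  assumes "n \<ge> 1" "stationary_measure n (generator \<gamma> \<gamma>' Tm Tp \<tau> n) \<mu>" "finite_second_moments n \<mu>"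
    and "\<gamma> > 0" "\<gamma>' > 0" "0 \<le> Tm" "0 \<le> Tp" "x \<in> {1..n}"
  shows "(\<integral>\<omega>. fst \<omega> x \<partial>\<mu>) = \<tau> * (\<gamma> * real x + (\<gamma>' - \<gamma>) / 2) / (real n * \<gamma> + \<gamma>')"
proof (rule affine_recurrence_solution[OF assms(1,4,5) _ _ _ _ assms(8)])
  have prob: "prob_space \<mu>" and sets: "sets \<mu> = sets (config_borel n)"
    using assms(2) by (auto simp: stationary_measure_def)
  interpret prob_space \<mu> by fact
  note int = integrable_coord(2)[OF prob sets assms(3)]
  have r: "integrable \<mu> (\<lambda>\<omega>. fst \<omega> x)" if "x \<in> {1..n}" for x
    using int[OF InlI[OF that]] by (simp add: coord.simps[abs_def])
  have p: "integrable \<mu> (\<lambda>\<omega>. snd \<omega> x)" if "x \<in> {0..n}" for x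
    using int[OF InrI[OF that]] by (simp add: coord.simps[abs_def])
  have drift: "(\<integral>\<omega>. coord_drift \<gamma> \<gamma>' \<tau> n j \<omega> \<partial>\<mu>) = 0" if "j \<in> coords n" for j
    using stationary_measure_integral_coord_drift[OF assms(1-3) that] assms(5-7) by simp
  show "(\<integral>\<omega>. snd \<omega> x \<partial>\<mu>) = (\<integral>\<omega>. snd \<omega> (x - 1) \<partial>\<mu>)" if "x \<in> {1..n}" for x
    using drift[OF InlI[OF that]] p[of x] p[of "x - 1"] that by auto
  show "(\<integral>\<omega>. fst \<omega> 1 \<partial>\<mu>) = (\<gamma> + \<gamma>') / 2 * (\<integral>\<omega>. snd \<omega> 0 \<partial>\<mu>)"
    using drift[OF InrI[of 0]] r[of 1] p[of 0] assms(1) by simp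
  show "(\<integral>\<omega>. fst \<omega> (x + 1) \<partial>\<mu>) = (\<integral>\<omega>. fst \<omega> x \<partial>\<mu>) + \<gamma> * (\<integral>\<omega>. snd \<omega> x \<partial>\<mu>)"
    if "x \<in> {1..<n}" for x
    using drift[OF InrI[of x]] r[of x] r[of "x + 1"] p[of x] that by auto
  show "\<tau> = (\<integral>\<omega>. fst \<omega> n \<partial>\<mu>) + (\<gamma> + \<gamma>') / 2 * (\<integral>\<omega>. snd \<omega> n \<partial>\<mu>)"
    using drift[OF InrI[of n]] r[of n] p[of n] assms(1) prob_space by simp
qed

theorem theorem3p1:
  fixes \<gamma> \<gamma>' Tm Tp \<tau> :: real and \<mu> :: "nat \<Rightarrow> config measure"
  assumes "\<gamma> > 0" and "\<gamma>' > 0" and "Tm > 0" and "Tp > 0"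
    and "\<And>n. n \<ge> 1 \<Longrightarrow> stationary_measure n (generator \<gamma> \<gamma>' Tm Tp \<tau> n) (\<mu> n)"
    and "\<And>n. n \<ge> 1 \<Longrightarrow> finite_second_moments n (\<mu> n)"
  shows "((\<lambda>n. SUP u\<in>{1 / real n..1}.
             \<bar>(\<integral>(r, p). r (nat \<lfloor>real n * u\<rfloor>) \<partial>\<mu> n) - r_ss \<tau> u\<bar>) \<longlonglongrightarrow> 0)
       \<and> (\<forall>G :: real \<Rightarrow> real. continuous_on {0..1} G \<longrightarrow>
            (\<lambda>n. 1 / real n * (\<Sum>x = 1..n. G (real x / real n) * (\<integral>(r, p). r x \<partial>\<mu> n)))
              \<longlonglongrightarrow> integral {0..1} (\<lambda>u. G u * r_ss \<tau> u))"
proof (intro conjI allI impI)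
  define C where "C = \<bar>\<tau>\<bar> * (\<gamma> + \<bar>\<gamma>' - \<gamma>\<bar> / 2 + \<gamma>') / \<gamma>"
  \<comment> \<open>Used twice: with \<open>x\<close> the integer part of \<open>n u\<close> for the
    supremum, and with \<open>u = x / n\<close> for the Riemann sum.\<close>
  have error: "\<bar>(\<integral>(r, p). r x \<partial>\<mu> n) - r_ss \<tau> u\<bar> \<le> C / real n"
    if "x \<in> {1..n}" "0 \<le> u" "u \<le> 1" "\<bar>real x - real n * u\<bar> \<le> 1" for n x u
  proof -
    have "n \<ge> 1" using that by auto
    then have "(\<integral>(r, p). r x \<partial>\<mu> n) = \<tau> * (\<gamma> * real x + (\<gamma>' - \<gamma>) / 2) / (real n * \<gamma> + \<gamma>')"
      using stationary_mean_stretch[OF _ assms(5) assms(6) assms(1,2)] assms(3,4) that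
      by (simp add: case_prod_unfold)
    then show ?thesis
      using affine_profile_error[OF assms(1,2) _ that(2-4), of \<tau>] \<open>n \<ge> 1\<close>
      by (simp add: C_def r_ss_def)
  qed
  have C_lim: "(\<lambda>n. B * (C / real n)) \<longlonglongrightarrow> 0" for B
    using tendsto_mult_right_zero[OF lim_const_over_n] .
  show "(\<lambda>n. SUP u\<in>{1 / real n..1}. \<bar>(\<integral>(r, p). r (nat \<lfloor>real n * u\<rfloor>) \<partial>\<mu> n) - r_ss \<tau> u\<bar>) \<longlonglongrightarrow> 0"
  proof (rule tendsto_sandwich[OF _ _ tendsto_const])
    have sup: "0 \<le> (SUP u\<in>{1 / real n..1}. \<bar>(\<integral>(r, p). r (nat \<lfloor>real n * u\<rfloor>) \<partial>\<mu> n) - r_ss \<tau> u\<bar>) \<and>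
        (SUP u\<in>{1 / real n..1}. \<bar>(\<integral>(r, p). r (nat \<lfloor>real n * u\<rfloor>) \<partial>\<mu> n) - r_ss \<tau> u\<bar>) \<le> 1 * (C / real n)"
      if "n \<ge> 1" for n
    proof -
      let ?f = "\<lambda>u. \<bar>(\<integral>(r, p). r (nat \<lfloor>real n * u\<rfloor>) \<partial>\<mu> n) - r_ss \<tau> u\<bar>"
      have le: "?f u \<le> C / real n" if "u \<in> {1 / real n..1}" for u
      proof (rule error)
        \<comment> \<open>The lower end \<open>1 / n\<close> of the range of \<open>u\<close> keeps
          the integer part of \<open>n u\<close> at least 1, hence a valid site.\<close>
        have u: "1 \<le> real n * u" "real n * u \<le> real n" "u \<le> 1"
          using that \<open>n \<ge> 1\<close> by (auto simp: field_simps mult_left_le)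
        then show "nat \<lfloor>real n * u\<rfloor> \<in> {1..n}" "\<bar>real (nat \<lfloor>real n * u\<rfloor>) - real n * u\<bar> \<le> 1" "u \<le> 1"
          by (auto simp: le_nat_iff nat_le_iff le_floor_iff floor_le_iff of_nat_nat) linarith+
        show "0 \<le> u"
          using that by (auto intro: order_trans[rotated])
      qed
      then have "bdd_above (?f ` {1 / real n..1})"
        by (intro bdd_aboveI2)
      moreover have one: "1 \<in> {1 / real n..1}"
        using that by simp
      \<comment> \<open>The supremum is nonnegative because it dominates the absolute value at
        \<open>u = 1\<close>; this uses the upper bound on the family.\<close>
      ultimately have "?f 1 \<le> (SUP u\<in>{1 / real n..1}. ?f u)"
        by (intro cSUP_upper)
      moreover have "(SUP u\<in>{1 / real n..1}. ?f u) \<le> C / real n"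
        using le one by (intro cSUP_least) auto
      ultimately show ?thesis by auto
    qed
    show "\<forall>\<^sub>F n in sequentially. 0 \<le> (SUP u\<in>{1 / real n..1}.
        \<bar>(\<integral>(r, p). r (nat \<lfloor>real n * u\<rfloor>) \<partial>\<mu> n) - r_ss \<tau> u\<bar>)"
      using eventually_ge_at_top[of 1] by eventually_elim (use sup in blast)
    show "\<forall>\<^sub>F n in sequentially. (SUP u\<in>{1 / real n..1}.
        \<bar>(\<integral>(r, p). r (nat \<lfloor>real n * u\<rfloor>) \<partial>\<mu> n) - r_ss \<tau> u\<bar>) \<le> 1 * (C / real n)"
      using eventually_ge_at_top[of 1] by eventually_elim (use sup in blast)
  qed (rule C_lim)
  fix G :: "real \<Rightarrow> real"
  assume G: "continuous_on {0..1} G"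
  then have "bounded (G ` {0..1})"
    by (intro compact_imp_bounded compact_continuous_image) auto
  then obtain B where B: "\<And>u. u \<in> {0..1} \<Longrightarrow> \<bar>G u\<bar> \<le> B"
    unfolding bounded_iff by (metis image_eqI real_norm_def)
  let ?m = "\<lambda>n x. \<integral>(r, p). r x \<partial>\<mu> n"
  \<comment> \<open>Replacing the means by the limit profile costs at most \<open>B * C / n\<close>
    on average, which reduces the claim to a Riemann sum.\<close>
  have "(\<lambda>n. 1 / real n * (\<Sum>x = 1..n. G (real x / real n) * (?m n x - r_ss \<tau> (real x / real n)))) \<longlonglongrightarrow> 0"
  proof (rule Lim_null_comparison[OF _ C_lim[of B]])
    show "\<forall>\<^sub>F n in sequentially.
        norm (1 / real n * (\<Sum>x = 1..n. G (real x / real n) * (?m n x - r_ss \<tau> (real x / real n)))) \<le> B * (C / real n)"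
      using eventually_ge_at_top[of 1]
    proof eventually_elim
      case (elim n)
      have "\<bar>G (real x / real n) * (?m n x - r_ss \<tau> (real x / real n))\<bar> \<le> B * (C / real n)"
        if "x \<in> {1..n}" for x
        \<comment> \<open>The instance \<open>B[of 0]\<close> shows that \<open>B\<close> is
          nonnegative, as monotonicity of the product requires.\<close>
        unfolding abs_mult using that elim B[of "real x / real n"] B[of 0]
        by (intro mult_mono error) auto
      then have "\<bar>\<Sum>x = 1..n. G (real x / real n) * (?m n x - r_ss \<tau> (real x / real n))\<bar>
          \<le> real n * (B * (C / real n))"
        by (intro order_trans[OF sum_abs] order_trans[OF sum_bounded_above[of _ _ "B * (C / real n)"]]) auto
      then show ?case
        using elim by (simp add: abs_mult field_simps)
    qed
  qed
  moreover have "(\<lambda>n. 1 / real n * (\<Sum>x = 1..n. G (real x / real n) * r_ss \<tau> (real x / real n)))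
      \<longlonglongrightarrow> integral {0..1} (\<lambda>u. G u * r_ss \<tau> u)"
    by (rule riemann_sum_tendsto_integral[of "\<lambda>u. G u * r_ss \<tau> u"])
      (auto simp: r_ss_def intro!: continuous_intros G)
  ultimately have "(\<lambda>n. 1 / real n * (\<Sum>x = 1..n. G (real x / real n) * (?m n x - r_ss \<tau> (real x / real n)))
      + 1 / real n * (\<Sum>x = 1..n. G (real x / real n) * r_ss \<tau> (real x / real n)))
      \<longlonglongrightarrow> 0 + integral {0..1} (\<lambda>u. G u * r_ss \<tau> u)"
    by (rule tendsto_add)
  then show "(\<lambda>n. 1 / real n * (\<Sum>x = 1..n. G (real x / real n) * ?m n x))
      \<longlonglongrightarrow> integral {0..1} (\<lambda>u. G u * r_ss \<tau> u)"
    by (simp add: right_diff_distrib sum_subtractf)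
qed

end
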